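(* Let $\Gamma'$ be the rank four incidence system defined in the context from the hemidodecahedron and its Petrie polygons. Then $\Gamma'$ is an incidence geometric representation for the group $A_5\times C_2$ (for which $\mathrm{Inn}(A_5\times C_2)\cong A_5$ and $\mathrm{Aut}(A_5\times C_2)\cong \mathrm{Sym}(5)$).
   Context: An incidence system is a quadruple $\Gamma=(X,*,t,I)$ where $X$ is a set of elements, $I$ a finite set of types, $t:X\to I$ a surjective type function, and $*$ a symmetric binary relation on $X$ (incidence) such that no two elements of the same type are incident. A correlation of $\Gamma$ is a permutation $\alpha$ of $X$ such that for all $x,y\in X$: $t(x)=t(y)\iff t(\alpha(x))=t(\alpha(y))$, and $x*y\iff \alpha(x)*\alpha(y)$. The correlations form a group $\mathrm{Aut}(\Gamma)$; its normal subgroup of type-preserving correlations is $\mathrm{Aut}_I(\Gamma)$. An incidence geometric representation for a group $G$ is an incidence system $\Gamma$ together with isomorphisms $\varphi_1:\mathrm{Inn}(G)\to\mathrm{Aut}_I(\Gamma)$ and $\varphi_2:\mathrm{Aut}(G)\to\mathrm{Aut}(\Gamma)$ with $\varphi_2|_{\mathrm{Inn}(G)}=\varphi_1$. Construction: the hemidodecahedron is the projective polyhedron obtained as the quotient of the regular dodecahedron by its central (antipodal) involution; it has 10 vertices, 15 edges and 6 pentagonal faces, and its vertex–edge graph is the Petersen graph. A Petrie polygon is a closed edge path in which any two consecutive edges, but no three consecutive edges, lie on a common face; the hemidodecahedron has 6 Petrie polygons, each a 5-cycle of the Petersen graph (the Petersen graph has twelve 5-cycles: the 6 faces and the 6 Petrie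 polygons). The elements of $\Gamma'$ of types $0,1,2,3$ are respectively the vertices, the edges, the faces and the Petrie polygons of the hemidodecahedron. Incidence among vertices, edges and faces is as in the hemidodecahedron (containment); a Petrie polygon is incident with the vertices and edges it contains; a face and a Petrie polygon are incident iff they share an edge. Thus the truncation of $\Gamma'$ to types $\{0,1,2\}$ is the hemidodecahedron and the truncation to types $\{0,1,3\}$ is isomorphic to it. *)

theory Defs
  imports "HOL-Algebra.Algebra"
begin

definition incidence_system :: "'x set \<Rightarrow> ('x \<Rightarrow> 'i) \<Rightarrow> ('x \<Rightarrow> 'x \<Rightarrow> bool) \<Rightarrow> bool" where
  "incidence_system E tp R \<longleftrightarrow>
     finite (tp ` E) \<and>
     (\<forall>x\<in>E. \<forall>y\<in>E. R x y \<longleftrightarrow> R y x) \<and>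
     (\<forall>x\<in>E. \<forall>y\<in>E. tp x = tp y \<longrightarrow> \<not> R x y)"

definition correlations :: "'x set \<Rightarrow> ('x \<Rightarrow> 'i) \<Rightarrow> ('x \<Rightarrow> 'x \<Rightarrow> bool) \<Rightarrow> ('x \<Rightarrow> 'x) set" where
  "correlations E tp R =
     {a \<in> Bij E. (\<forall>x\<in>E. \<forall>y\<in>E. (tp x = tp y \<longleftrightarrow> tp (a x) = tp (a y))
                               \<and> (R x y \<longleftrightarrow> R (a x) (a y)))}"

definition type_preserving_correlations ::
  "'x set \<Rightarrow> ('x \<Rightarrow> 'i) \<Rightarrow> ('x \<Rightarrow> 'x \<Rightarrow> bool) \<Rightarrow> ('x \<Rightarrow> 'x) set" where
  "type_preserving_correlations E tp R =
     {a \<in> correlations E tp R. \<forall>x\<in>E. tp (a x) = tp x}"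

definition CorGroup :: "'x set \<Rightarrow> ('x \<Rightarrow> 'i) \<Rightarrow> ('x \<Rightarrow> 'x \<Rightarrow> bool) \<Rightarrow> ('x \<Rightarrow> 'x) monoid" where
  "CorGroup E tp R = BijGroup E \<lparr>carrier := correlations E tp R\<rparr>"

definition CorGroupI :: "'x set \<Rightarrow> ('x \<Rightarrow> 'i) \<Rightarrow> ('x \<Rightarrow> 'x \<Rightarrow> bool) \<Rightarrow> ('x \<Rightarrow> 'x) monoid" where
  "CorGroupI E tp R = BijGroup E \<lparr>carrier := type_preserving_correlations E tp R\<rparr>"

definition InnGroup :: "('a, 'b) monoid_scheme \<Rightarrow> ('a \<Rightarrow> 'a) monoid" where
  "InnGroup G = AutoGroup G \<lparr>carrier :=
     {(\<lambda>x\<in>carrier G. g \<otimes>\<^bsub>G\<^esub> x \<otimes>\<^bsub>G\<^esub> inv\<^bsub>G\<^esub> g) | g. g \<in> carrier G}\<rparr>"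

definition incidence_geometric_representation ::
  "('a, 'b) monoid_scheme \<Rightarrow> 'x set \<Rightarrow> ('x \<Rightarrow> 'i) \<Rightarrow> ('x \<Rightarrow> 'x \<Rightarrow> bool) \<Rightarrow> bool" where
  "incidence_geometric_representation G E tp R \<longleftrightarrow>
     incidence_system E tp R \<and>
     (\<exists>\<phi>1 \<phi>2. \<phi>1 \<in> iso (InnGroup G) (CorGroupI E tp R) \<and>
              \<phi>2 \<in> iso (AutoGroup G) (CorGroup E tp R) \<and>
              (\<forall>g\<in>carrier (InnGroup G). \<phi>2 g = \<phi>1 g))"

text \<open>Vertices of the hemidodecahedron are the 2-subsets of {1..5}; two are
  joined by an edge iff disjoint (Petersen graph).  An edge is the set of its
  two end vertices; a face or a Petrie polygon is the set of its edges.\<close>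

definition hd_vertices :: "nat set set" where
  "hd_vertices = {v. v \<subseteq> {1..5} \<and> card v = 2}"

definition hd_edges :: "nat set set set" where
  "hd_edges = {{v, w} | v w. v \<in> hd_vertices \<and> w \<in> hd_vertices \<and> v \<inter> w = {}}"

definition pentagon :: "nat \<Rightarrow> nat \<Rightarrow> nat \<Rightarrow> nat \<Rightarrow> nat \<Rightarrow> nat set set set" where
  "pentagon a b c d e =
     {{{a,b},{c,d}}, {{c,d},{e,a}}, {{e,a},{b,c}}, {{b,c},{d,e}}, {{d,e},{a,b}}}"

text \<open>The six faces of the hemidodecahedron (the A5-orbit of pentagon 1 2 3 4 5).\<close>

definition hd_faces :: "nat set set set set" where
  "hd_faces = {pentagon 1 2 3 4 5, pentagon 1 2 4 5 3, pentagon 1 2 5 3 4,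
               pentagon 1 3 2 5 4, pentagon 1 3 4 2 5, pentagon 1 4 2 3 5}"

text \<open>A Petrie polygon: the edge set of a closed edge path (cyclic list of
  distinct edges, consecutive edges sharing a vertex, never turning back at the
  same vertex) in which any two consecutive edges lie on a common face but no
  three consecutive edges do.\<close>

definition petrie_polygon :: "nat set set set \<Rightarrow> bool" where
  "petrie_polygon p \<longleftrightarrow>
     (\<exists>es. distinct es \<and> length es \<ge> 3 \<and> set es \<subseteq> hd_edges \<and> set es = p \<and>
        (\<forall>i < length es.
           let n = length es; a = es ! i; b = es ! ((i + 1) mod n); c = es ! ((i + 2) mod n)
           in a \<inter> b \<noteq> {} \<and> a \<inter> b \<noteq> b \<inter> c \<and>
              (\<exists>f\<in>hd_faces. a \<in> f \<and> b \<in> f) \<and>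
              \<not> (\<exists>f\<in>hd_faces. a \<in> f \<and> b \<in> f \<and> c \<in> f)))"

definition hd_petrie :: "nat set set set set" where
  "hd_petrie = {p. petrie_polygon p}"

datatype elem = Vx "nat set" | Ed "nat set set" | Fc "nat set set set" | Pt "nat set set set"

fun gtype :: "elem \<Rightarrow> nat" where
  "gtype (Vx _) = 0" | "gtype (Ed _) = 1" | "gtype (Fc _) = 2" | "gtype (Pt _) = 3"

definition gelems :: "elem set" where
  "gelems = Vx ` hd_vertices \<union> Ed ` hd_edges \<union> Fc ` hd_faces \<union> Pt ` hd_petrie"

fun inc0 :: "elem \<Rightarrow> elem \<Rightarrow> bool" where
  "inc0 (Vx v) (Ed e) = (v \<in> e)"
| "inc0 (Vx v) (Fc f) = (v \<in> \<Union> f)"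
| "inc0 (Vx v) (Pt p) = (v \<in> \<Union> p)"
| "inc0 (Ed e) (Fc f) = (e \<in> f)"
| "inc0 (Ed e) (Pt p) = (e \<in> p)"
| "inc0 (Fc f) (Pt p) = (f \<inter> p \<noteq> {})"
| "inc0 _ _ = False"

definition ginc :: "elem \<Rightarrow> elem \<Rightarrow> bool" where
  "ginc x y \<longleftrightarrow> inc0 x y \<or> inc0 y x"

end

theory Submission
  imports Defs
begin

text \<open>
  Both groups of the representation are identified with the symmetric group on five points.

  On the geometric side, a permutation of the points acts on the Petersen graph and hence on its
  twelve pentagons. Even permutations preserve the set of six faces, odd ones exchange it with the
  other six pentagons, and the latter are the Petrie polygons: any path of three edges lies in a
  unique pentagon, and continuing it without ever following three edges of a face stays in that
  pentagon. So the symmetric group acts by correlations, and exactly the even permutations preserve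
  types. Conversely, the numbers 10, 15, 6, 6 of elements of each type force a correlation to map
  vertices to vertices and edges to edges; it permutes the five maximal independent sets (stars) of
  the Petersen graph and is induced by the resulting permutation of the points.

  On the group side, an automorphism of the direct product preserves the central factor and also
  the alternating factor, which has no nontrivial homomorphism to a group of order two. An
  automorphism of the
  alternating group sends the generators (1 2 3), (1 2 4), (1 2 5) to 3-cycles with pairwise
  products of order two; such 3-cycles traverse a common arc, so they are the conjugates of the
  generators by a permutation.
\<close>

section \<open>Faces and Petrie polygons\<close>

abbreviation polygon_image :: "(nat \<Rightarrow> nat) \<Rightarrow> nat set set set \<Rightarrow> nat set set set" where
  "polygon_image s \<equiv> image (image (image s))"

text \<open>The vertices of the pentagon are the sides of the 5-cycle \<open>a b c d e\<close> on
  the points, adjacent when disjoint, so the dihedral symmetries of that 5-cycle leave the pentagon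
  unchanged.\<close>

lemma pentagon_rotate: "pentagon b c d e a = pentagon a b c d e"
  unfolding pentagon_def by (simp add: insert_commute)

lemma pentagon_reflect: "pentagon a e d c b = pentagon a b c d e"
  unfolding pentagon_def by (simp add: insert_commute)

lemma polygon_image_pentagon:
  "polygon_image s (pentagon a b c d e) = pentagon (s a) (s b) (s c) (s d) (s e)"
  unfolding pentagon_def by simp

text \<open>The orbit of \<open>pentagon 1 2 3 5 4\<close> under the alternating group.\<close>

definition nonfaces :: "nat set set set set" where
  "nonfaces = {pentagon 1 2 3 5 4, pentagon 1 2 4 3 5, pentagon 1 2 5 4 3,
               pentagon 1 3 2 4 5, pentagon 1 3 5 2 4, pentagon 1 4 3 2 5}"

text \<open>Rewrite rules to be used with \<open>pentagon_orient\<close>: the point 1 comes first,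
  and the smaller of its two neighbours in the 5-cycle comes second. Each pentagon then has one
  normal form, and \<open>hd_faces\<close> and \<open>nonfaces\<close> are listed in it.\<close>

lemma pentagon_1_in_front:
  "pentagon a 1 c d e = pentagon 1 c d e a"
  "pentagon a b 1 d e = pentagon 1 d e a b"
  "pentagon a b c 1 e = pentagon 1 e a b c"
  "pentagon a b c d 1 = pentagon 1 a b c d"
  by (metis pentagon_rotate)+

lemma pentagon_orient:
  "e < b \<Longrightarrow> pentagon 1 b c d e = pentagon 1 e d c b"
  by (rule pentagon_reflect)

lemmas pentagon_normalize = polygon_image_pentagon pentagon_1_in_front pentagon_orient

lemma atLeastAtMost_1_5: "{1..5} = {1, 2, 3, 4, 5::nat}"
  by auto

text \<open>A finite check over all pairs \<open>a\<close>, \<open>b\<close> and all twelve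
  pentagons, decided by comparing normal forms.\<close>

lemma transpose_swaps_faces:
  assumes "a \<in> {1..5}" "b \<in> {1..5}" "a \<noteq> b"
  shows "f \<in> hd_faces \<Longrightarrow> polygon_image (transpose a b) f \<in> nonfaces"
    and "f \<in> nonfaces \<Longrightarrow> polygon_image (transpose a b) f \<in> hd_faces"
proof -
  have "a \<in> {1,2,3,4,5} \<Longrightarrow> b \<in> {1,2,3,4,5} \<Longrightarrow> a \<noteq> b \<Longrightarrow>
        (\<forall>f\<in>hd_faces. polygon_image (transpose a b) f \<in> nonfaces) \<and>
        (\<forall>f\<in>nonfaces. polygon_image (transpose a b) f \<in> hd_faces)"
    \<comment> \<open>\<open>One_nat_def\<close> is switched off because the normalizing rules match
      the literal 1.\<close>
    by (elim insertE emptyE)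
       (hypsubst, simp add: hd_faces_def nonfaces_def pentagon_normalize transpose_apply_other
                       del: One_nat_def)+
  then show "f \<in> hd_faces \<Longrightarrow> polygon_image (transpose a b) f \<in> nonfaces"
    and "f \<in> nonfaces \<Longrightarrow> polygon_image (transpose a b) f \<in> hd_faces"
    using assms unfolding atLeastAtMost_1_5 by simp_all
qed

lemma faces_disjoint_nonfaces: "hd_faces \<inter> nonfaces = {}"
  by code_simp

lemma card_hd_faces: "card hd_faces = 6"
  by code_simp

lemma card_nonfaces: "card nonfaces = 6"
  by code_simp

text \<open>Induction over transpositions: each factor swaps the two lists and flips the
  parity.\<close>

lemma polygon_image_faces_nonfaces:
  assumes "s permutes {1..5}"
  shows "f \<in> hd_faces \<Longrightarrow> polygon_image s f \<in> (if evenperm s then hd_faces else nonfaces)"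
    and "f \<in> nonfaces \<Longrightarrow> polygon_image s f \<in> (if evenperm s then nonfaces else hd_faces)"
proof -
  have "(\<forall>f\<in>hd_faces. polygon_image s f \<in> (if evenperm s then hd_faces else nonfaces)) \<and>
        (\<forall>f\<in>nonfaces. polygon_image s f \<in> (if evenperm s then nonfaces else hd_faces))"
    using assms finite_atLeastAtMost
  proof (induction rule: permutes_induct)
    case id
    then show ?case by simp
  next
    case (swap a b p)
    have "evenperm (transpose a b \<circ> p) \<longleftrightarrow> \<not> evenperm p"
      using swap.hyps by (simp add: evenperm_comp permutation_swap_id evenperm_swap
          permutes_imp_permutation [of "{1..5}"])
    moreover have "polygon_image (transpose a b \<circ> p) f = polygon_image (transpose a b) (polygon_image p f)" for f
      by (simp add: image_comp comp_def)
    ultimately show ?case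
      using swap.IH transpose_swaps_faces [OF swap.hyps(1-3)]
      by (cases "evenperm p") (simp_all only: if_True if_False not_True_eq_False not_False_eq_True, blast+)
  qed
  then show "f \<in> hd_faces \<Longrightarrow> polygon_image s f \<in> (if evenperm s then hd_faces else nonfaces)"
    and "f \<in> nonfaces \<Longrightarrow> polygon_image s f \<in> (if evenperm s then nonfaces else hd_faces)"
    by blast+
qed

lemma permutation_with_values:
  assumes "distinct [a,b,c,d,e]" "{a,b,c,d,e} \<subseteq> {1..5}"
  obtains s where "s permutes {1..5}" "s 1 = a" "s 2 = b" "s 3 = c" "s 4 = d" "s 5 = (e::nat)"
proof -
  define s where "s = id(1 := a, 2 := b, 3 := c, 4 := d, 5 := e)"
  have vals: "s 1 = a" "s 2 = b" "s 3 = c" "s 4 = d" "s 5 = e"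
    by (simp_all add: s_def)
  have image: "s ` {1..5} = {a,b,c,d,e}"
    unfolding atLeastAtMost_1_5 by (simp only: image_insert image_empty vals)
  have "distinct (map s [1,2,3,4,5])"
    using assms(1) by (simp only: list.map vals)
  then have "inj_on s {1..5}"
    unfolding distinct_map atLeastAtMost_1_5 by simp
  then have "bij_betw s {1..5} {1..5}"
    unfolding bij_betw_def using endo_inj_surj [of "{1..5}" s] assms(2)
    by (simp only: image finite_atLeastAtMost)
  moreover have "s x = x" if "x \<notin> {1..5}" for x
    using that by (auto simp: s_def)
  ultimately have "s permutes {1..5}"
    by (rule bij_imp_permutes)
  then show thesis
    using that vals by blast
qed

text \<open>Every labelling is an image of \<open>pentagon 1 2 3 4 5\<close>, so the two lists
  exhaust the pentagons.\<close>

lemma pentagon_in_faces_or_nonfaces: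
  assumes "distinct [a,b,c,d,e]" "{a,b,c,d,e} \<subseteq> {1..5}"
  shows "pentagon a b c d e \<in> hd_faces \<union> nonfaces"
proof -
  obtain s where s: "s permutes {1..5}" "s 1 = a" "s 2 = b" "s 3 = c" "s 4 = d" "s 5 = e"
    using permutation_with_values [OF assms] by blast
  have "pentagon 1 2 3 4 5 \<in> hd_faces"
    by (simp add: hd_faces_def)
  from polygon_image_faces_nonfaces(1) [OF s(1) this] show ?thesis
    unfolding polygon_image_pentagon s by (simp split: if_splits)
qed

section \<open>Edge paths of length three and the determination of the Petrie polygons\<close>

lemma hd_edgesI:
  assumes "distinct [a,b,c,d]" "{a,b,c,d} \<subseteq> {1..5}"
  shows "{{a,b},{c,d}} \<in> hd_edges"
proof -
  have "{a,b} \<in> hd_vertices" "{c,d} \<in> hd_vertices" "{a,b} \<inter> {c,d} = {}"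
    using assms by (auto simp: hd_vertices_def)
  then show ?thesis
    unfolding hd_edges_def by blast
qed

lemma pentagon_subset_hd_edges:
  assumes "distinct [a,b,c,d,e]" "{a,b,c,d,e} \<subseteq> {1..5}"
  shows "pentagon a b c d e \<subseteq> hd_edges"
  unfolding pentagon_def using assms by (auto intro!: hd_edgesI)

lemma hd_edgesE:
  assumes "e \<in> hd_edges" "v \<in> e"
  obtains w where "e = {v, w}" "v \<in> hd_vertices" "w \<in> hd_vertices" "v \<inter> w = {}"
  using assms unfolding hd_edges_def by (auto simp: insert_commute Int_commute)

lemma hd_verticesE:
  assumes "v \<in> hd_vertices" "a \<in> v"
  obtains b where "v = {a, b}" "a \<noteq> b"
proof -
  obtain x y where "v = {x, y}" "x \<noteq> y"
    using assms(1) by (auto simp: hd_vertices_def card_2_iff)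
  with assms(2) that show thesis
    by (cases "a = x") (auto simp: insert_commute)
qed

text \<open>The edges obtained are the first three of \<open>pentagon p q r s t\<close>, which
  places every such path in a pentagon. The last hypothesis excludes turning back and three edges at
  one vertex.\<close>

lemma path_of_three_edges_labels:
  assumes edges: "a \<in> hd_edges" "b \<in> hd_edges" "c \<in> hd_edges"
    and ne: "a \<noteq> b" "b \<noteq> c"
    and adj: "a \<inter> b \<noteq> {}" "b \<inter> c \<noteq> {}" "a \<inter> b \<noteq> b \<inter> c"
  obtains p q r s t where "distinct [p,q,r,s,t]" "{p,q,r,s,t} = {1..5}"
    "a = {{p,q},{r,s}}" "b = {{r,s},{t,p}}" "c = {{t,p},{q,r}}"
proof -
  obtain v1 where v1: "v1 \<in> a" "v1 \<in> b"
    using adj(1) by blast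
  obtain v0 where a: "a = {v1, v0}" "v0 \<in> hd_vertices" "v1 \<inter> v0 = {}"
    using edges(1) v1(1) by (rule hd_edgesE)
  obtain v2 where b: "b = {v1, v2}" "v1 \<in> hd_vertices" "v2 \<in> hd_vertices" "v1 \<inter> v2 = {}"
    using edges(2) v1(2) by (rule hd_edgesE)
  have "v0 \<noteq> v2"
    using ne(1) a b by blast
  then have "a \<inter> b = {v1}"
    using a(1) b(1) by auto
  have "v2 \<in> c"
  proof (rule ccontr)
    assume "v2 \<notin> c"
    then have "b \<inter> c = {v1}"
      using adj(2) b(1) by auto
    with adj(3) \<open>a \<inter> b = {v1}\<close> show False by simp
  qed
  then obtain v3 where c: "c = {v2, v3}" "v3 \<in> hd_vertices" "v2 \<inter> v3 = {}"
    using edges(3) by (metis hd_edgesE)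
  have "v3 \<noteq> v1"
    using ne(2) b c by blast
  have v: "v0 \<subseteq> {1..5}" "v1 \<subseteq> {1..5}" "v2 \<subseteq> {1..5}" "v3 \<subseteq> {1..5}"
    "card v0 = 2" "card v1 = 2" "card v2 = 2" "card v3 = 2"
    using a b c by (auto simp: hd_vertices_def)
  then have fin: "finite v0" "finite v1" "finite v2" "finite v3"
    by (auto intro: finite_subset)
  \<comment> \<open>\<open>v0\<close> and \<open>v2\<close> are 2-sets in the three-point complement
    of \<open>v1\<close>, so they meet.\<close>
  have "card ((v0 \<union> v2) \<union> v1) \<le> card {1..5::nat}"
    using v by (intro card_mono) auto
  moreover have "card ((v0 \<union> v2) \<union> v1) = card (v0 \<union> v2) + 2"
    using v fin a b by (subst card_Un_disjoint) auto
  ultimately have "v0 \<inter> v2 \<noteq> {}"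
    using v fin card_Un_disjoint [of v0 v2] by auto
  then obtain p where p: "p \<in> v0" "p \<in> v2" by blast
  obtain q where q: "v0 = {p, q}" "p \<noteq> q"
    using hd_verticesE [OF a(2) p(1)] .
  obtain t where t: "v2 = {p, t}" "p \<noteq> t"
    using hd_verticesE [OF b(3) p(2)] .
  obtain x y where xy: "v1 = {x, y}" "x \<noteq> y"
    using v(6) by (auto simp: card_2_iff)
  have "q \<noteq> t"
    using q t \<open>v0 \<noteq> v2\<close> by blast
  then have "card {p,q,t,x,y} = 5"
    using q t xy a(3) b(4) by auto
  moreover have "{p,q,t,x,y} \<subseteq> {1..5}"
    using v q t xy by blast
  ultimately have all: "{p,q,t,x,y} = {1..5}"
    by (intro card_subset_eq) auto
  \<comment> \<open>\<open>v3\<close> lies in the complement of \<open>v2\<close> and differs from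
    \<open>v1\<close>, which forces it to contain \<open>q\<close>.\<close>
  have "v3 \<subseteq> {q,x,y}"
    using v(4) c(3) t unfolding all [symmetric] by blast
  moreover have "\<not> v3 \<subseteq> {x,y}"
    using card_subset_eq [of v1 v3] v fin \<open>v3 \<noteq> v1\<close> xy by auto
  ultimately have "q \<in> v3" by blast
  then obtain r where r: "v3 = {q, r}" "q \<noteq> r"
    using c(2) by (metis hd_verticesE)
  define s where "s = (if r = x then y else x)"
  have "r \<in> {x,y}"
    using r \<open>v3 \<subseteq> {q,x,y}\<close> by auto
  then have rs: "v1 = {r, s}" "r \<noteq> s"
    using xy by (auto simp: s_def)
  show thesis
  proof (rule that [of p q r s t])
    show "distinct [p,q,r,s,t]"
      using q t r rs \<open>q \<noteq> t\<close> a(3) b(4) by auto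
    show "{p,q,r,s,t} = {1..5}"
      using all rs xy by auto
  qed (simp_all add: a(1) b(1) c(1) q(1) t(1) r(1) rs(1) insert_commute)
qed

text \<open>Three transpositions, \<open>p\<close> with \<open>r\<close>, \<open>q\<close> with
  \<open>s\<close> and \<open>q\<close> with \<open>t\<close>, lead from one labelling to the other,
  and an odd number of swaps changes the list.\<close>

lemma transposed_pentagon:
  assumes "distinct [p,q,r,s,t]" "{p,q,r,s,t} = {1..5}" "pentagon p q r s t \<in> nonfaces"
  shows "pentagon r s p t q \<in> hd_faces"
proof -
  have mem: "p \<in> {1..5}" "q \<in> {1..5}" "r \<in> {1..5}" "s \<in> {1..5}" "t \<in> {1..5}"
    unfolding assms(2) [symmetric] by simp_all
  have "pentagon r q p s t \<in> hd_faces"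
    using transpose_swaps_faces(2) [OF mem(1,3) _ assms(3)] assms(1)
    by (auto simp: polygon_image_pentagon)
  then have "pentagon r s p q t \<in> nonfaces"
    using transpose_swaps_faces(1) [OF mem(2,4), of "pentagon r q p s t"] assms(1)
    by (auto simp: polygon_image_pentagon)
  then show ?thesis
    using transpose_swaps_faces(2) [OF mem(2,5), of "pentagon r s p q t"] assms(1)
    by (auto simp: polygon_image_pentagon)
qed

text \<open>The only other way to continue the path is through \<open>{s, p}\<close>; it lies in \<open>pentagon r s p t q\<close>,
  an odd relabelling of \<open>pentagon p q r s t\<close> and therefore a face.\<close>

lemma petrie_path_next_edge:
  assumes labels: "distinct [p,q,r,s,t]" "{p,q,r,s,t} = {1..5}"
    and nonface: "pentagon p q r s t \<in> nonfaces"
    and b: "b = {{r,s},{t,p}}" and c: "c = {{t,p},{q,r}}"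
    and d: "d \<in> hd_edges" "c \<noteq> d" "c \<inter> d \<noteq> {}" "b \<inter> c \<noteq> c \<inter> d"
    and no_face: "\<not> (\<exists>f\<in>hd_faces. b \<in> f \<and> c \<in> f \<and> d \<in> f)"
  shows "d = {{q,r},{s,t}}"
proof -
  have bc: "b \<in> hd_edges" "c \<in> hd_edges"
    unfolding b c using labels by (auto intro!: hd_edgesI)
  have "b \<noteq> c" "b \<inter> c \<noteq> {}"
    using labels unfolding b c by (auto simp: doubleton_eq_iff)
  then obtain p' q' r' s' t' where l': "distinct [p',q',r',s',t']"
    "b = {{p',q'},{r',s'}}" "c = {{r',s'},{t',p'}}" "d = {{t',p'},{q',r'}}"
    using path_of_three_edges_labels [OF bc d(1)] d by metis
  \<comment> \<open>Comparing the fresh labels of the path \<open>b\<close>, \<open>c\<close>,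
    \<open>d\<close> with the known ones on \<open>b\<close> and \<open>c\<close> leaves only the
    choice of \<open>r'\<close>, that is, of the last vertex of the path.\<close>
  have "{r',s'} = {t,p}" "{p',q'} = {r,s}" "{t',p'} = {q,r}"
    using l'(1-3) labels(1) unfolding b c by (auto simp: doubleton_eq_iff)
  then have eqs: "p' = r" "q' = s" "t' = q"  and r': "r' = t \<and> s' = p \<or> r' = p \<and> s' = t"
    using l'(1) labels(1) by (auto simp: doubleton_eq_iff)
  from r' show ?thesis
  proof
    assume "r' = t \<and> s' = p"
    then show ?thesis
      using l'(4) eqs by (auto simp: insert_commute)
  next
    assume "r' = p \<and> s' = t"
    then have "b \<in> pentagon r s p t q" "c \<in> pentagon r s p t q" "d \<in> pentagon r s p t q"
      using l' eqs by (auto simp: pentagon_def)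
    with transposed_pentagon [OF labels nonface] no_face show ?thesis by blast
  qed
qed

text \<open>The first three edges fix a pentagon that is no face; every further edge is forced to
  stay in it, so the path closes after five edges.\<close>

lemma petrie_polygon_imp_nonface:
  assumes "petrie_polygon p"
  shows "p \<in> nonfaces"
proof -
  obtain es where es: "distinct es" "length es \<ge> 3" "set es \<subseteq> hd_edges" "set es = p"
    and steps: "\<And>i. i < length es \<Longrightarrow>
           es ! i \<inter> es ! ((i + 1) mod length es) \<noteq> {} \<and>
           es ! i \<inter> es ! ((i + 1) mod length es) \<noteq>
             es ! ((i + 1) mod length es) \<inter> es ! ((i + 2) mod length es) \<and>
           \<not> (\<exists>f\<in>hd_faces. es ! i \<in> f \<and> es ! ((i + 1) mod length es) \<in> f \<and>
                           es ! ((i + 2) mod length es) \<in> f)"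
    using assms unfolding petrie_polygon_def Let_def by blast
  define n where "n = length es"
  \<comment> \<open>Indices are read modulo \<open>n\<close>, so successors wrap around the closed
    path without case distinctions.\<close>
  define e where "e i = es ! (i mod n)" for i
  have n: "n \<ge> 3"
    using es(2) by (simp add: n_def)
  have lt: "i mod n < length es" for i
    unfolding n_def using es(2) by (intro mod_less_divisor) linarith
  have edge: "e i \<in> hd_edges" for i
    using es(3) nth_mem [OF lt] unfolding e_def by blast
  have eq_iff: "e i = e j \<longleftrightarrow> i mod n = j mod n" for i j
    unfolding e_def using es(1) lt by (simp add: nth_eq_iff_index_eq)
  have ne: "e i \<noteq> e (Suc i)" for i
    using n by (auto simp: eq_iff mod_Suc)
  have step: "e i \<inter> e (i+1) \<noteq> {}" "e i \<inter> e (i+1) \<noteq> e (i+1) \<inter> e (i+2)"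
    "\<not> (\<exists>f\<in>hd_faces. e i \<in> f \<and> e (i+1) \<in> f \<and> e (i+2) \<in> f)" for i
    using steps [of "i mod n"] n unfolding e_def n_def [symmetric] by (simp_all add: mod_simps)
  have ne': "e 0 \<noteq> e 1" "e 1 \<noteq> e 2" "e 2 \<noteq> e 3" "e 3 \<noteq> e 4" "e 4 \<noteq> e 5"
    using ne [of 0] ne [of 1] ne [of 2] ne [of 3] ne [of 4] by (simp_all add: eval_nat_numeral)
  have meet: "e 0 \<inter> e 1 \<noteq> {}" "e 1 \<inter> e 2 \<noteq> {}" "e 2 \<inter> e 3 \<noteq> {}" "e 3 \<inter> e 4 \<noteq> {}" "e 4 \<inter> e 5 \<noteq> {}"
    using step(1) [of 0] step(1) [of 1] step(1) [of 2] step(1) [of 3] step(1) [of 4]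
    by (simp_all add: eval_nat_numeral)
  have turn: "e 0 \<inter> e 1 \<noteq> e 1 \<inter> e 2" "e 1 \<inter> e 2 \<noteq> e 2 \<inter> e 3"
    "e 2 \<inter> e 3 \<noteq> e 3 \<inter> e 4" "e 3 \<inter> e 4 \<noteq> e 4 \<inter> e 5"
    using step(2) [of 0] step(2) [of 1] step(2) [of 2] step(2) [of 3]
    by (simp_all add: eval_nat_numeral)
  have no_face: "\<not> (\<exists>f\<in>hd_faces. e 0 \<in> f \<and> e 1 \<in> f \<and> e 2 \<in> f)"
    "\<not> (\<exists>f\<in>hd_faces. e 1 \<in> f \<and> e 2 \<in> f \<and> e 3 \<in> f)"
    "\<not> (\<exists>f\<in>hd_faces. e 2 \<in> f \<and> e 3 \<in> f \<and> e 4 \<in> f)"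
    "\<not> (\<exists>f\<in>hd_faces. e 3 \<in> f \<and> e 4 \<in> f \<and> e 5 \<in> f)"
    using step(3) [of 0] step(3) [of 1] step(3) [of 2] step(3) [of 3]
    by (simp_all add: eval_nat_numeral)
  obtain a b c d f where labels: "distinct [a,b,c,d,f]" "{a,b,c,d,f} = {1..5}"
    and e012: "e 0 = {{a,b},{c,d}}" "e 1 = {{c,d},{f,a}}" "e 2 = {{f,a},{b,c}}"
    by (rule path_of_three_edges_labels [OF edge edge edge ne'(1,2) meet(1,2) turn(1)])
  have "e 0 \<in> pentagon a b c d f" "e 1 \<in> pentagon a b c d f" "e 2 \<in> pentagon a b c d f"
    unfolding e012 pentagon_def by simp_all
  then have "pentagon a b c d f \<notin> hd_faces"
    using no_face(1) by blast
  then have nf: "pentagon a b c d f \<in> nonfaces"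
    using pentagon_in_faces_or_nonfaces [OF labels(1)] labels(2) by simp
  have e3: "e 3 = {{b,c},{d,f}}"
    by (rule petrie_path_next_edge [OF labels nf e012(2,3) edge ne'(3) meet(3) turn(2) no_face(2)])
  \<comment> \<open>The forced continuation applies again, with the labels rotated by two places
    each time.\<close>
  have e4: "e 4 = {{d,f},{a,b}}"
  proof (rule petrie_path_next_edge [OF _ _ _ _ _ edge ne'(4) meet(4) turn(3) no_face(3)])
    show "distinct [c,d,f,a,b]"
      using labels(1) by auto
    show "{c,d,f,a,b} = {1..5}"
      unfolding labels(2) [symmetric] by blast
    show "pentagon c d f a b \<in> nonfaces"
      using nf by (metis pentagon_rotate)
  qed (simp_all add: e012 e3)
  have e5: "e 5 = {{a,b},{c,d}}"
  proof (rule petrie_path_next_edge [OF _ _ _ _ _ edge ne'(5) meet(5) turn(4) no_face(4)])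
    show "distinct [f,a,b,c,d]"
      using labels(1) by auto
    show "{f,a,b,c,d} = {1..5}"
      unfolding labels(2) [symmetric] by blast
    show "pentagon f a b c d \<in> nonfaces"
      using nf by (metis pentagon_rotate)
  qed (simp_all add: e3 e4)
  \<comment> \<open>As the listed edges are distinct, the return at index 5 is a divisibility
    statement about \<open>n\<close>, and \<open>n \<ge> 3\<close> leaves length five.\<close>
  have "e 5 = e 0"
    using e5 e012 by simp
  then have "n dvd 5"
    by (simp add: eq_iff mod_eq_0_iff_dvd)
  then have "n = 5"
  proof -
    have "n = 3 \<or> n = 4 \<or> n = 5"
      using n dvd_imp_le [OF \<open>n dvd 5\<close>] by auto
    with \<open>n dvd 5\<close> show ?thesis by auto
  qed
  have "set es = (\<lambda>i. es ! i) ` {..<n}"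
    unfolding n_def set_conv_nth by auto
  also have "\<dots> = e ` {..<n}"
    by (auto simp: e_def)
  also have "{..<n} = {0,1,2,3,4}"
    using \<open>n = 5\<close> by auto
  finally have "p = e ` {0,1,2,3,4}"
    using es(4) by simp
  also have "\<dots> = pentagon a b c d f"
    unfolding pentagon_def by (simp only: e012 e3 e4 image_insert image_empty)
  finally show ?thesis
    using nf by simp
qed

text \<open>The edges in path order, since a Petrie polygon is witnessed by a cyclic list.\<close>

definition pentagon_walk :: "nat \<Rightarrow> nat \<Rightarrow> nat \<Rightarrow> nat \<Rightarrow> nat \<Rightarrow> nat set set list" where
  "pentagon_walk a b c d e =
     [{{a,b},{c,d}}, {{c,d},{e,a}}, {{e,a},{b,c}}, {{b,c},{d,e}}, {{d,e},{a,b}}]"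

text \<open>The path conditions are evaluated on explicit lists; the clause on
  \<open>hd_edges\<close> is supplied later by \<open>nonfaces_subset_hd_edges\<close>.\<close>

lemma pentagon_walk_petrie:
  "\<forall>es \<in> {pentagon_walk 1 2 3 5 4, pentagon_walk 1 2 4 3 5, pentagon_walk 1 2 5 4 3,
           pentagon_walk 1 3 2 4 5, pentagon_walk 1 3 5 2 4, pentagon_walk 1 4 3 2 5}.
     distinct es \<and> length es \<ge> 3 \<and>
     (\<forall>i < length es.
        let n = length es; a = es ! i; b = es ! ((i + 1) mod n); c = es ! ((i + 2) mod n)
        in a \<inter> b \<noteq> {} \<and> a \<inter> b \<noteq> b \<inter> c \<and>
           (\<exists>f\<in>hd_faces. a \<in> f \<and> b \<in> f) \<and>
           \<not> (\<exists>f\<in>hd_faces. a \<in> f \<and> b \<in> f \<and> c \<in> f))"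
  by code_simp

lemma nonfaces_subset_hd_edges: "f \<in> nonfaces \<Longrightarrow> f \<subseteq> hd_edges"
  unfolding nonfaces_def by (elim insertE emptyE; hypsubst; rule pentagon_subset_hd_edges; simp)

lemma hd_faces_subset_hd_edges: "f \<in> hd_faces \<Longrightarrow> f \<subseteq> hd_edges"
  unfolding hd_faces_def by (elim insertE emptyE; hypsubst; rule pentagon_subset_hd_edges; simp)

lemma hd_petrie_eq_nonfaces: "hd_petrie = nonfaces"
proof
  show "hd_petrie \<subseteq> nonfaces"
    unfolding hd_petrie_def using petrie_polygon_imp_nonface by blast
  show "nonfaces \<subseteq> hd_petrie"
  proof
    fix p assume p: "p \<in> nonfaces"
    have walk: "set (pentagon_walk a b c d e) = pentagon a b c d e" for a b c d e
      by (simp add: pentagon_walk_def pentagon_def)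
    obtain es where es: "set es = p"
      "es \<in> {pentagon_walk 1 2 3 5 4, pentagon_walk 1 2 4 3 5, pentagon_walk 1 2 5 4 3,
           pentagon_walk 1 3 2 4 5, pentagon_walk 1 3 5 2 4, pentagon_walk 1 4 3 2 5}"
      using p unfolding nonfaces_def walk [symmetric] by blast
    show "p \<in> hd_petrie"
      unfolding hd_petrie_def mem_Collect_eq petrie_polygon_def
      using pentagon_walk_petrie [rule_format, OF es(2)] es(1) nonfaces_subset_hd_edges [OF p]
      by blast
  qed
qed

section \<open>Correlations\<close>

text \<open>An odd permutation exchanges the constructors \<open>Fc\<close> and \<open>Pt\<close>
  because it moves each polygon to the other list.\<close>

fun act :: "(nat \<Rightarrow> nat) \<Rightarrow> elem \<Rightarrow> elem" where
  "act s (Vx v) = Vx (s ` v)"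
| "act s (Ed e) = Ed ((`) s ` e)"
| "act s (Fc f) = (if evenperm s then Fc else Pt) (polygon_image s f)"
| "act s (Pt f) = (if evenperm s then Pt else Fc) (polygon_image s f)"

lemma act_id: "act id x = x"
  by (cases x) (simp_all add: id_def)

lemma act_comp:
  assumes "permutation s" "permutation t"
  shows "act (s \<circ> t) x = act s (act t x)"
  by (cases x) (simp_all add: evenperm_comp assms image_image)

lemma hd_vertices_image:
  assumes "s permutes {1..5}" "v \<in> hd_vertices"
  shows "s ` v \<in> hd_vertices"
proof -
  have "s ` v \<subseteq> {1..5}"
    using assms(2) permutes_image [OF assms(1)] unfolding hd_vertices_def by blast
  moreover have "card (s ` v) = card v"
    using permutes_inj [OF assms(1)] by (metis card_image inj_on_subset subset_UNIV)
  ultimately show ?thesis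
    using assms(2) by (simp add: hd_vertices_def)
qed

lemma hd_edges_image:
  assumes "s permutes {1..5}" "e \<in> hd_edges"
  shows "(`) s ` e \<in> hd_edges"
proof -
  obtain v w where e: "e = {v, w}" "v \<in> hd_vertices" "w \<in> hd_vertices" "v \<inter> w = {}"
    using assms(2) unfolding hd_edges_def by blast
  have "s ` v \<inter> s ` w = {}"
    using e(4) image_Int [OF permutes_inj [OF assms(1)], of v w] by simp
  then show ?thesis
    using hd_vertices_image [OF assms(1)] e(1-3) unfolding hd_edges_def image_insert image_empty e(1)
    by blast
qed

lemma act_gelems:
  assumes "s permutes {1..5}" "x \<in> gelems"
  shows "act s x \<in> gelems"
proof (cases x)
  case (Fc f)
  then show ?thesis
    using assms(2) polygon_image_faces_nonfaces(1) [OF assms(1), of f]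
    by (auto simp: gelems_def hd_petrie_eq_nonfaces)
next
  case (Pt f)
  then show ?thesis
    using assms(2) polygon_image_faces_nonfaces(2) [OF assms(1), of f]
    by (auto simp: gelems_def hd_petrie_eq_nonfaces)
qed (use assms in \<open>auto simp: gelems_def hd_vertices_image hd_edges_image\<close>)

lemma ginc_simps [simp]:
  "ginc (Vx v) (Vx w) \<longleftrightarrow> False"
  "ginc (Vx v) (Ed e) \<longleftrightarrow> v \<in> e" "ginc (Ed e) (Vx v) \<longleftrightarrow> v \<in> e"
  "ginc (Vx v) (Fc f) \<longleftrightarrow> v \<in> \<Union>f" "ginc (Fc f) (Vx v) \<longleftrightarrow> v \<in> \<Union>f"
  "ginc (Vx v) (Pt f) \<longleftrightarrow> v \<in> \<Union>f" "ginc (Pt f) (Vx v) \<longleftrightarrow> v \<in> \<Union>f"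
  "ginc (Ed e) (Ed e') \<longleftrightarrow> False"
  "ginc (Ed e) (Fc f) \<longleftrightarrow> e \<in> f" "ginc (Fc f) (Ed e) \<longleftrightarrow> e \<in> f"
  "ginc (Ed e) (Pt f) \<longleftrightarrow> e \<in> f" "ginc (Pt f) (Ed e) \<longleftrightarrow> e \<in> f"
  "ginc (Fc f) (Fc g) \<longleftrightarrow> False" "ginc (Pt f) (Pt g) \<longleftrightarrow> False"
  "ginc (Fc f) (Pt g) \<longleftrightarrow> f \<inter> g \<noteq> {}" "ginc (Pt f) (Fc g) \<longleftrightarrow> f \<inter> g \<noteq> {}"
  by (auto simp: ginc_def)

lemma inj_set_image: "inj f \<Longrightarrow> inj ((`) f)"
  by (rule injI) (simp add: inj_image_eq_iff)

text \<open>Incidence is membership or nonempty intersection and treats \<open>Fc\<close> and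
  \<open>Pt\<close> alike, so exchanging them throughout does no harm; injectivity preserves
  membership and disjointness.\<close>

lemma ginc_act:
  assumes "inj s"
  shows "ginc (act s x) (act s y) \<longleftrightarrow> ginc x y"
proof -
  have inj2: "inj ((`) s)"
    using assms by (rule inj_set_image)
  then have inj3: "inj ((`) ((`) s))"
    by (rule inj_set_image)
  have Union: "\<Union> (polygon_image s f) = (`) s ` \<Union> f" for f
    by (simp add: image_Union)
  have disj: "polygon_image s f \<inter> polygon_image s g = {} \<longleftrightarrow> f \<inter> g = {}" for f g
    using image_Int [OF inj3, of f g] by (metis image_is_empty)
  show ?thesis
    by (cases x; cases y; simp only: act.simps ginc_simps Union disj inj_image_mem_iff [OF inj2]
          inj_image_mem_iff [OF inj3] split: if_split; simp)
qed

lemma gtype_act: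
  "gtype (act s x) = (if evenperm s then gtype x else transpose 2 3 (gtype x))"
  by (cases x) (simp_all add: transpose_apply_other)

lemma restrict_act_in_correlations:
  assumes "s permutes {1..5}"
  shows "restrict (act s) gelems \<in> correlations gelems gtype ginc"
proof -
  have inv: "inv' s permutes {1..5}"
    using assms by (rule permutes_inv)
  have perm: "permutation s" "permutation (inv' s)"
    using assms inv by (auto simp: permutation_permutes)
  have "act (inv' s) (act s x) = x" "act s (act (inv' s) x) = x" for x
    using act_comp [OF perm(2,1), of x] act_comp [OF perm, of x] permutes_inv_o [OF assms]
    by (simp_all add: act_id)
  then have "bij_betw (act s) gelems gelems"
    by (intro bij_betwI [where g = "act (inv' s)"]) (auto simp: act_gelems [OF assms] act_gelems [OF inv])
  then have "restrict (act s) gelems \<in> Bij gelems"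
    by (simp add: Bij_def)
  moreover have "gtype x = gtype y \<longleftrightarrow> gtype (act s x) = gtype (act s y)" for x y
    by (auto simp: gtype_act dest: transpose_eq_imp_eq)
  ultimately show ?thesis
    using ginc_act [OF permutes_inj [OF assms]] by (simp add: correlations_def)
qed

text \<open>Pairwise intersecting 2-sets form a star or lie in a triangle, and a triangle has only
  three sides. This recognizes the image of a star under a correlation as a star.\<close>

lemma common_element_of_intersecting_pairs:
  assumes card2: "\<And>A. A \<in> F \<Longrightarrow> card A = 2"
    and meet: "\<And>A B. A \<in> F \<Longrightarrow> B \<in> F \<Longrightarrow> A \<inter> B \<noteq> {}"
    and "card F \<ge> 4"
  shows "\<exists>m. \<forall>A\<in>F. m \<in> A"
proof (rule ccontr)
  assume no: "\<nexists>m. \<forall>A\<in>F. m \<in> A"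
  have other: "\<exists>y. A = {x, y} \<and> x \<noteq> y" if "A \<in> F" "x \<in> A" for A x
    using card2 [OF that(1)] that(2) by (auto simp: card_2_iff)
  have "F \<noteq> {}"
    using assms(3) by auto
  then obtain A where A: "A \<in> F" by blast
  then obtain a where "a \<in> A"
    using card2 by fastforce
  then obtain B where B: "B \<in> F" "a \<notin> B"
    using no by blast
  then obtain b where b: "b \<in> A" "b \<in> B"
    using meet [OF A B(1)] by blast
  have Aab: "A = {a, b}"
    using other [OF A \<open>a \<in> A\<close>] b B(2) by auto
  obtain c where c: "B = {b, c}" "b \<noteq> c"
    using other [OF B(1) b(2)] by blast
  obtain C where C: "C \<in> F" "b \<notin> C"
    using no by blast
  have "a \<in> C" "c \<in> C"
    using meet [OF A C(1)] meet [OF B(1) C(1)] C(2) Aab c by auto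
  then have Cac: "C = {a, c}"
    using other [OF C(1)] B(2) c by auto
  \<comment> \<open>\<open>A\<close>, \<open>B\<close>, \<open>C\<close> are the sides of a
    triangle, and a 2-set meeting all three sides contains two of its corners.\<close>
  have "F \<subseteq> {A, B, C}"
  proof
    fix D assume D: "D \<in> F"
    have "D \<inter> {a,b} \<noteq> {}" "D \<inter> {b,c} \<noteq> {}" "D \<inter> {a,c} \<noteq> {}"
      using meet [OF D A] meet [OF D B(1)] meet [OF D C(1)] Aab c Cac by auto
    then have "a \<in> D \<and> b \<in> D \<or> b \<in> D \<and> c \<in> D \<or> a \<in> D \<and> c \<in> D"
      by auto
    moreover have "a \<noteq> b" "a \<noteq> c"
      using b B(2) c by auto
    ultimately show "D \<in> {A, B, C}"
      using card2 [OF D] c(2) unfolding Aab c(1) Cac by (auto simp: card_2_iff)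
  qed
  then have "card F \<le> card {A, B, C}"
    by (intro card_mono) auto
  also have "\<dots> \<le> 3"
    by (simp add: card_insert_if)
  finally show False
    using assms(3) by simp
qed

section \<open>Numbers of vertices and edges, and of vertices through a point\<close>

lemma hd_verticesI: "i \<in> {1..5} \<Longrightarrow> j \<in> {1..5} \<Longrightarrow> i \<noteq> j \<Longrightarrow> {i,j} \<in> hd_vertices"
  by (simp add: hd_vertices_def)

lemma card_hd_vertices: "card hd_vertices = 10"
  unfolding hd_vertices_def n_subsets [OF finite_atLeastAtMost] by (simp add: choose_two)

lemma card_hd_edges: "card hd_edges = 15"
proof -
  \<comment> \<open>Both sets are rewritten as filters of finite sets so that evaluation can count
    them.\<close>
  have V: "hd_vertices = Set.filter (\<lambda>v. card v = 2) (Pow {1,2,3,4,5})"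
    unfolding hd_vertices_def atLeastAtMost_1_5 by auto
  have E: "hd_edges = (\<lambda>(v, w). {v, w}) ` Set.filter (\<lambda>(v, w). v \<inter> w = {}) (hd_vertices \<times> hd_vertices)"
    unfolding hd_edges_def by auto
  show ?thesis
    unfolding E V by code_simp
qed

lemma card_star:
  assumes "i \<in> {1..5}"
  shows "card {v \<in> hd_vertices. i \<in> v} = 4"
proof -
  have "{v \<in> hd_vertices. i \<in> v} = (\<lambda>j. {i, j}) ` ({1..5} - {i})"
  proof
    show "{v \<in> hd_vertices. i \<in> v} \<subseteq> (\<lambda>j. {i, j}) ` ({1..5} - {i})"
    proof
      fix v assume v: "v \<in> {v \<in> hd_vertices. i \<in> v}"
      then obtain j where j: "v = {i, j}" "i \<noteq> j"
        by (auto elim: hd_verticesE)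
      moreover have "j \<in> {1..5}"
        using v j(1) by (auto simp: hd_vertices_def)
      ultimately show "v \<in> (\<lambda>j. {i, j}) ` ({1..5} - {i})" by blast
    qed
    show "(\<lambda>j. {i, j}) ` ({1..5} - {i}) \<subseteq> {v \<in> hd_vertices. i \<in> v}"
      using assms by (auto simp: hd_vertices_def)
  qed
  moreover have "inj_on (\<lambda>j. {i, j}) ({1..5} - {i})"
    by (auto simp: inj_on_def doubleton_eq_iff)
  ultimately show ?thesis
    using assms by (simp add: card_image)
qed


section \<open>Faithfulness of the action, and recovery of the permutation from a
  correlation\<close>

lemma act_type_preserving_iff:
  "(\<forall>x\<in>gelems. gtype (act s x) = gtype x) \<longleftrightarrow> evenperm s"
proof -
  have "Fc (pentagon 1 2 3 4 5) \<in> gelems"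
    by (simp add: gelems_def hd_faces_def)
  then show ?thesis
    unfolding gtype_act by force
qed

text \<open>Two different vertices through \<open>i\<close> meet only in \<open>i\<close>, so their
  images already determine the value at \<open>i\<close>.\<close>

lemma act_inj:
  assumes "s permutes {1..5}" "t permutes {1..5}"
    and eq: "\<And>x. x \<in> gelems \<Longrightarrow> act s x = act t x"
  shows "s = t"
proof
  fix i
  show "s i = t i"
  proof (cases "i \<in> {1..5}")
    case False
    then show ?thesis
      using assms(1,2) by (simp add: permutes_not_in)
  next
    case True
    have image_eq: "s ` {i, j} = t ` {i, j}" if "j \<in> {1..5} - {i}" for j
      using eq [of "Vx {i, j}"] hd_verticesI [of i j] True that by (auto simp: gelems_def)
    have "card ({1..5} - {i}) = 4"
      using True by simp
    then have "\<exists>j k. j \<in> {1..5} - {i} \<and> k \<in> {1..5} - {i} \<and> j \<noteq> k"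
      by (metis card_le_Suc0_iff_eq finite_Diff finite_atLeastAtMost numeral_le_one_iff One_nat_def semiring_norm(69))
    then obtain j k where jk: "j \<in> {1..5} - {i}" "k \<in> {1..5} - {i}" "j \<noteq> k" by blast
    have "inj s" "inj t"
      using assms(1,2) by (auto intro: permutes_inj)
    then have "s j \<noteq> s k" "s i \<noteq> s j" "s i \<noteq> s k" "t i \<noteq> t j"
      using jk by (auto dest: injD)
    then show ?thesis
      using image_eq [OF jk(1)] image_eq [OF jk(2)] by (auto simp: doubleton_eq_iff)
  qed
qed

text \<open>Equality of types is preserved in both directions, so type classes are mapped onto type
  classes.\<close>

lemma correlation_fibre_card:
  assumes "a \<in> correlations E tp R" "x \<in> E"
  shows "card {y\<in>E. tp y = tp (a x)} = card {y\<in>E. tp y = tp x}"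
proof -
  have bij: "bij_betw a E E"
    and tp: "\<And>x y. x \<in> E \<Longrightarrow> y \<in> E \<Longrightarrow> tp x = tp y \<longleftrightarrow> tp (a x) = tp (a y)"
    using assms(1) by (auto simp: correlations_def Bij_def)
  have image: "a ` {y\<in>E. tp y = tp x} = {y\<in>E. tp y = tp (a x)}"
  proof
    show "a ` {y\<in>E. tp y = tp x} \<subseteq> {y\<in>E. tp y = tp (a x)}"
      using tp assms(2) bij_betwE [OF bij] by auto
    show "{y\<in>E. tp y = tp (a x)} \<subseteq> a ` {y\<in>E. tp y = tp x}"
    proof
      fix z assume z: "z \<in> {y\<in>E. tp y = tp (a x)}"
      then obtain y where "y \<in> E" "z = a y"
        using bij_betw_imp_surj_on [OF bij] by blast
      with z tp assms(2) show "z \<in> a ` {y\<in>E. tp y = tp x}" by auto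
    qed
  qed
  have "inj_on a {y\<in>E. tp y = tp x}"
    using bij_betw_imp_inj_on [OF bij] by (rule inj_on_subset) auto
  from card_image [OF this] show ?thesis
    unfolding image .
qed

lemma card_gelems_of_type:
  "card {y\<in>gelems. gtype y = 0} = 10" "card {y\<in>gelems. gtype y = 1} = 15"
  "card {y\<in>gelems. gtype y = 2} = 6" "card {y\<in>gelems. gtype y = 3} = 6"
proof -
  have "{y\<in>gelems. gtype y = 0} = Vx ` hd_vertices" "{y\<in>gelems. gtype y = 1} = Ed ` hd_edges"
    "{y\<in>gelems. gtype y = 2} = Fc ` hd_faces" "{y\<in>gelems. gtype y = 3} = Pt ` nonfaces"
    by (auto simp: gelems_def hd_petrie_eq_nonfaces)
  then show "card {y\<in>gelems. gtype y = 0} = 10" "card {y\<in>gelems. gtype y = 1} = 15"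
    "card {y\<in>gelems. gtype y = 2} = 6" "card {y\<in>gelems. gtype y = 3} = 6"
    by (simp_all add: card_image inj_on_def card_hd_vertices card_hd_edges card_hd_faces card_nonfaces)
qed

text \<open>The class sizes 10, 15, 6, 6 single out the types 0 and 1; only 2 and 3 can be
  exchanged.\<close>

lemma gtype_correlation:
  assumes "a \<in> correlations gelems gtype ginc" "x \<in> gelems"
  shows "gtype (a x) = 0 \<longleftrightarrow> gtype x = 0" "gtype (a x) = 1 \<longleftrightarrow> gtype x = 1"
proof -
  have types: "gtype y \<in> {0,1,2,3}" for y
    by (cases y) auto
  define N where "N k = card {y\<in>gelems. gtype y = k}" for k
  have N: "N 0 = 10" "N 1 = 15" "N 2 = 6" "N 3 = 6"
    by (simp_all only: N_def card_gelems_of_type)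
  have "N (gtype (a x)) = N (gtype x)"
    unfolding N_def by (rule correlation_fibre_card [OF assms])
  then show "gtype (a x) = 0 \<longleftrightarrow> gtype x = 0" "gtype (a x) = 1 \<longleftrightarrow> gtype x = 1"
    using N types [of x] types [of "a x"] by (auto simp del: One_nat_def)
qed

text \<open>The image of an edge is incident with the images of both ends; these are distinct, and
  an edge has no other vertices. Here \<open>h\<close> is the induced map on vertices, not yet known
  to come from a map of points.\<close>

lemma correlation_on_edges:
  assumes a: "a \<in> correlations gelems gtype ginc"
    and h: "\<And>v. v \<in> hd_vertices \<Longrightarrow> h v \<in> hd_vertices \<and> a (Vx v) = Vx (h v)"
    and e: "v \<in> hd_vertices" "w \<in> hd_vertices" "v \<inter> w = {}"
  shows "a (Ed {v, w}) = Ed {h v, h w}" "h v \<inter> h w = {}"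
proof -
  have inj: "inj_on a gelems" and mem: "\<And>x. x \<in> gelems \<Longrightarrow> a x \<in> gelems"
    and inc: "\<And>x y. x \<in> gelems \<Longrightarrow> y \<in> gelems \<Longrightarrow> ginc (a x) (a y) \<longleftrightarrow> ginc x y"
    using a by (auto simp: correlations_def Bij_def bij_betw_def)
  have "{v, w} \<in> hd_edges"
    using e unfolding hd_edges_def by blast
  then have g: "Vx v \<in> gelems" "Vx w \<in> gelems" "Ed {v, w} \<in> gelems"
    using e by (auto simp: gelems_def)
  have "gtype (a (Ed {v, w})) = 1"
    using gtype_correlation(2) [OF a g(3)] by simp
  then obtain e' where e': "a (Ed {v, w}) = Ed e'"
    by (cases "a (Ed {v, w})") auto
  then have "e' \<in> hd_edges"
    using mem [OF g(3)] by (auto simp: gelems_def)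
  have "h v \<in> e'" "h w \<in> e'"
    using inc [OF g(1,3)] inc [OF g(2,3)] h e e' by auto
  moreover have "h v \<noteq> h w"
  proof
    assume "h v = h w"
    then have "a (Vx v) = a (Vx w)"
      using h e by simp
    then have "v = w"
      using inj g by (auto dest: inj_onD)
    then show False
      using e by (auto simp: hd_vertices_def)
  qed
  ultimately have "e' = {h v, h w} \<and> h v \<inter> h w = {}"
    using \<open>e' \<in> hd_edges\<close> unfolding hd_edges_def by auto
  then show "a (Ed {v, w}) = Ed {h v, h w}" "h v \<inter> h w = {}"
    using e' by auto
qed

lemma correlation_induced_by_permutation:
  assumes a: "a \<in> correlations gelems gtype ginc"
  obtains s where "s permutes {1..5}" "a = restrict (act s) gelems"
proof -
  have inj: "inj_on a gelems" and surj: "a ` gelems = gelems"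
    and ext: "a \<in> extensional gelems"
    and inc: "\<And>x y. x \<in> gelems \<Longrightarrow> y \<in> gelems \<Longrightarrow> ginc (a x) (a y) \<longleftrightarrow> ginc x y"
    using a by (auto simp: correlations_def Bij_def bij_betw_def)
  have mem: "a x \<in> gelems" if "x \<in> gelems" for x
    using surj that by blast
  have "\<exists>w. w \<in> hd_vertices \<and> a (Vx v) = Vx w" if "v \<in> hd_vertices" for v
  proof -
    have v: "Vx v \<in> gelems"
      using that by (simp add: gelems_def)
    have "gtype (a (Vx v)) = 0"
      using gtype_correlation(1) [OF a v] by simp
    then show ?thesis
      using mem [OF v] by (cases "a (Vx v)") (auto simp: gelems_def)
  qed
  then obtain h where h: "h v \<in> hd_vertices \<and> a (Vx v) = Vx (h v)" if "v \<in> hd_vertices" for v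
    by metis
  note on_edges = correlation_on_edges [OF a h]
  have h_inj: "inj_on h hd_vertices"
  proof (rule inj_onI)
    fix v w assume vw: "v \<in> hd_vertices" "w \<in> hd_vertices" "h v = h w"
    then have "a (Vx v) = a (Vx w)"
      using h by simp
    then show "v = w"
      using inj vw by (auto simp: gelems_def dest: inj_onD)
  qed
  \<comment> \<open>The converse of \<open>on_edges\<close>: by surjectivity the edge joining
    \<open>h v\<close> and \<open>h w\<close> is the image of an edge, whose ends are
    \<open>v\<close> and \<open>w\<close>.\<close>
  have h_disjoint: "v \<inter> w = {}" if "v \<in> hd_vertices" "w \<in> hd_vertices" "h v \<inter> h w = {}" for v w
  proof -
    have "{h v, h w} \<in> hd_edges"
      using that h unfolding hd_edges_def by blast
    then have "Ed {h v, h w} \<in> gelems"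
      by (simp add: gelems_def)
    then obtain x where x: "x \<in> gelems" "a x = Ed {h v, h w}"
      using surj by (metis imageE)
    then have "gtype x = 1"
      using gtype_correlation(2) [OF a x(1)] by simp
    then obtain e where e: "x = Ed e"
      by (cases x) auto
    have "e \<in> hd_edges"
      using x e by (auto simp: gelems_def)
    moreover have "v \<in> e" "w \<in> e"
      using inc [of "Vx v" x] inc [of "Vx w" x] that h x e by (auto simp: gelems_def)
    moreover have "v \<noteq> w"
      using that(3) h [OF that(1)] by (auto simp: hd_vertices_def)
    ultimately show ?thesis
      unfolding hd_edges_def by auto
  qed
  \<comment> \<open>The four vertices through \<open>i\<close> meet pairwise, and by
    \<open>h_disjoint\<close> so do their images. These therefore share a point, the future value of
    the permutation at \<open>i\<close>.\<close>
  have "\<exists>m. \<forall>v\<in>hd_vertices. i \<in> v \<longrightarrow> m \<in> h v" if i: "i \<in> {1..5}" for i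
  proof -
    let ?S = "{v \<in> hd_vertices. i \<in> v}"
    have "\<exists>m. \<forall>A\<in>h ` ?S. m \<in> A"
    proof (rule common_element_of_intersecting_pairs)
      show "card A = 2" if "A \<in> h ` ?S" for A
        using that h by (auto simp: hd_vertices_def)
      show "A \<inter> B \<noteq> {}" if "A \<in> h ` ?S" "B \<in> h ` ?S" for A B
        using that h_disjoint by blast
      have "inj_on h ?S"
        using h_inj by (rule inj_on_subset) auto
      then show "4 \<le> card (h ` ?S)"
        using card_star [OF i] by (simp add: card_image)
    qed
    then show ?thesis by blast
  qed
  then obtain m where m: "\<And>i v. i \<in> {1..5} \<Longrightarrow> v \<in> hd_vertices \<Longrightarrow> i \<in> v \<Longrightarrow> m i \<in> h v"
    by metis
  \<comment> \<open>Outside the five points \<open>permutes\<close> demands the identity.\<close>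
  define s where "s i = (if i \<in> {1..5} then m i else i)" for i
  have s_mem: "s i \<in> h v" if "v \<in> hd_vertices" "i \<in> v" for i v
    using that m [of i v] by (auto simp: s_def hd_vertices_def)
  \<comment> \<open>Equal values would give a common point to the images of the disjoint vertices
    \<open>{i,k}\<close> and \<open>{j,l}\<close>.\<close>
  have s_inj: "s i \<noteq> s j" if ij: "i \<in> {1..5}" "j \<in> {1..5}" "i \<noteq> j" for i j
  proof
    assume eq: "s i = s j"
    have "card ({1..5} - {i,j}) = 3"
      using ij by (simp add: card_Diff_subset)
    then obtain k l n where kln: "{1..5} - {i,j} = {k,l,n}" "k \<noteq> l"
      by (auto simp: card_3_iff)
    then have kl: "k \<in> {1..5} - {i,j}" "l \<in> {1..5} - {i,j}"
      by auto
    have v: "{i,k} \<in> hd_vertices" "{j,l} \<in> hd_vertices" "{i,k} \<inter> {j,l} = {}"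
      using ij kl kln(2) by (auto simp: hd_vertices_def)
    have "s i \<in> h {i,k}" "s j \<in> h {j,l}"
      using s_mem v by auto
    then show False
      using on_edges(2) [OF _ v] eq by auto
  qed
  have "s ` {1..5} \<subseteq> {1..5}"
  proof
    fix x assume "x \<in> s ` {1..5}"
    then obtain i where i: "i \<in> {1..5}" "x = s i" by blast
    obtain v where "v \<in> hd_vertices" "i \<in> v"
      using card_star [OF i(1)] by (metis (mono_tags, lifting) card.empty empty_Collect_eq zero_neq_numeral)
    then have "s i \<in> h v" "h v \<in> hd_vertices"
      using s_mem h by auto
    then show "x \<in> {1..5}"
      using i(2) by (auto simp: hd_vertices_def)
  qed
  moreover have "inj_on s {1..5}"
    using s_inj unfolding inj_on_def by blast
  ultimately have "bij_betw s {1..5} {1..5}"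
    unfolding bij_betw_def using endo_inj_surj [of "{1..5}" s] by (simp only: finite_atLeastAtMost)
  then have perm: "s permutes {1..5}"
    by (rule bij_imp_permutes) (auto simp: s_def)
  have h_eq: "h v = s ` v" if v: "v \<in> hd_vertices" for v
  proof -
    have "s ` v \<subseteq> h v"
      using s_mem v by blast
    moreover have "card (s ` v) = card (h v)" "finite (h v)"
      using h [OF v] v hd_vertices_image [OF perm v] by (auto simp: hd_vertices_def intro: finite_subset)
    ultimately show ?thesis
      by (metis card_subset_eq)
  qed
  have on_Vx: "a (Vx v) = act s (Vx v)" if "v \<in> hd_vertices" for v
    using h [OF that] h_eq [OF that] by simp
  have on_Ed: "a (Ed e) = act s (Ed e)" if "e \<in> hd_edges" for e
  proof -
    obtain v w where vw: "e = {v, w}" "v \<in> hd_vertices" "w \<in> hd_vertices" "v \<inter> w = {}"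
      using \<open>e \<in> hd_edges\<close> unfolding hd_edges_def by blast
    show ?thesis
      using on_edges(1) [OF _ vw(2-4)] h_eq vw by simp
  qed
  \<comment> \<open>A polygon is determined by the edges incident with it. Whether the image is a
    face or a Petrie polygon is left open at this stage.\<close>
  have polygon: "g = polygon_image s f"
    if x: "x \<in> gelems" "x = Fc f \<or> x = Pt f" and y: "a x = Fc g \<or> a x = Pt g" for x f g
  proof -
    have "f \<in> hd_faces \<union> nonfaces" "g \<in> hd_faces \<union> nonfaces"
      using x y mem [OF x(1)] by (auto simp: gelems_def hd_petrie_eq_nonfaces)
    then have sub: "f \<subseteq> hd_edges" "g \<subseteq> hd_edges"
      using hd_faces_subset_hd_edges nonfaces_subset_hd_edges by blast+
    have iff: "e \<in> f \<longleftrightarrow> (`) s ` e \<in> g" if "e \<in> hd_edges" for e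
      using inc [of "Ed e" x] x y on_Ed [OF that] that by (auto simp: gelems_def)
    show ?thesis
    proof
      show "polygon_image s f \<subseteq> g"
        using iff sub by blast
      show "g \<subseteq> polygon_image s f"
      proof
        fix e assume "e \<in> g"
        then have e: "e \<in> hd_edges"
          using sub by blast
        define e' where "e' = (`) (inv' s) ` e"
        have "e' \<in> hd_edges"
          unfolding e'_def using hd_edges_image [OF permutes_inv [OF perm] e] .
        moreover have "(`) s ` e' = e"
          unfolding e'_def by (simp add: image_image permutes_inverses [OF perm])
        ultimately show "e \<in> polygon_image s f"
          using iff \<open>e \<in> g\<close> by auto
      qed
    qed
  qed
  have "a x = act s x" if x: "x \<in> gelems" for x
  proof -
    have not01: "gtype (a x) \<noteq> 0 \<and> gtype (a x) \<noteq> 1" if "gtype x \<noteq> 0" "gtype x \<noteq> 1"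
      using gtype_correlation [OF a x] that by blast
    show ?thesis
    proof (cases x)
      case (Vx v)
      then show ?thesis using on_Vx x by (auto simp: gelems_def)
    next
      case (Ed e)
      then show ?thesis using on_Ed x by (auto simp: gelems_def)
    next
      case (Fc f)
      then obtain g where g: "a x = Fc g \<or> a x = Pt g"
        using not01 by (cases "a x") auto
      have "g = polygon_image s f"
        using polygon [OF x _ g] Fc by blast
      moreover have "f \<in> hd_faces"
        using x Fc by (auto simp: gelems_def)
      \<comment> \<open>The parity of \<open>s\<close> now decides the constructor, because the two
        lists are disjoint.\<close>
      ultimately show ?thesis
        using polygon_image_faces_nonfaces(1) [OF perm, of f] g mem [OF x] faces_disjoint_nonfaces Fc
        by (auto simp: gelems_def hd_petrie_eq_nonfaces)
    next
      case (Pt f)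
      then obtain g where g: "a x = Fc g \<or> a x = Pt g"
        using not01 by (cases "a x") auto
      have "g = polygon_image s f"
        using polygon [OF x _ g] Pt by blast
      moreover have "f \<in> nonfaces"
        using x Pt by (auto simp: gelems_def hd_petrie_eq_nonfaces)
      ultimately show ?thesis
        using polygon_image_faces_nonfaces(2) [OF perm, of f] g mem [OF x] faces_disjoint_nonfaces Pt
        by (auto simp: gelems_def hd_petrie_eq_nonfaces)
    qed
  qed
  then have "a = restrict (act s) gelems"
    using ext by (auto simp: extensional_def restrict_def fun_eq_iff)
  with perm show thesis
    by (rule that)
qed

section \<open>The incidence system and its groups of correlations\<close>

lemma incidence_system_gelems: "incidence_system gelems gtype ginc"
proof -
  have "gtype x \<in> {0,1,2,3}" for x
    by (cases x) auto
  then have "gtype ` gelems \<subseteq> {0,1,2,3}"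
    by (rule image_subsetI)
  then have "finite (gtype ` gelems)"
    by (rule finite_subset) simp
  moreover have "\<not> ginc x y" if "gtype x = gtype y" for x y
    using that by (cases x; cases y) simp_all
  ultimately show ?thesis
    unfolding incidence_system_def by (auto simp: ginc_def)
qed

lemma act_iso: "(\<lambda>s. restrict (act s) gelems) \<in> iso (sym_group 5) (CorGroup gelems gtype ginc)"
proof (rule isoI)
  show "(\<lambda>s. restrict (act s) gelems) \<in> hom (sym_group 5) (CorGroup gelems gtype ginc)"
  proof (rule homI)
    fix s t assume "s \<in> carrier (sym_group 5)" "t \<in> carrier (sym_group 5)"
    then have st: "s permutes {1..5}" "t permutes {1..5}"
      by (simp_all add: sym_group_carrier)
    then have perm: "permutation s" "permutation t"
      by (auto simp: permutation_permutes)
    note cor = restrict_act_in_correlations [OF st(1)] restrict_act_in_correlations [OF st(2)]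
    show "restrict (act s) gelems \<in> carrier (CorGroup gelems gtype ginc)"
      using cor(1) by (simp add: CorGroup_def)
    have "restrict (act s) gelems \<in> Bij gelems" "restrict (act t) gelems \<in> Bij gelems"
      using cor by (simp_all add: correlations_def)
    moreover have "restrict (act (s \<circ> t)) gelems =
        compose gelems (restrict (act s) gelems) (restrict (act t) gelems)"
      by (auto simp: compose_def restrict_def fun_eq_iff act_comp [OF perm] act_gelems [OF st(2)])
    ultimately show "restrict (act (s \<otimes>\<^bsub>sym_group 5\<^esub> t)) gelems =
      restrict (act s) gelems \<otimes>\<^bsub>CorGroup gelems gtype ginc\<^esub> restrict (act t) gelems"
      by (simp add: CorGroup_def BijGroup_def sym_group_mult)
  qed
  show "bij_betw (\<lambda>s. restrict (act s) gelems) (carrier (sym_group 5)) (carrier (CorGroup gelems gtype ginc))"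
    unfolding bij_betw_def
  proof
    show "inj_on (\<lambda>s. restrict (act s) gelems) (carrier (sym_group 5))"
    proof (rule inj_onI)
      fix s t assume st: "s \<in> carrier (sym_group 5)" "t \<in> carrier (sym_group 5)"
        "restrict (act s) gelems = restrict (act t) gelems"
      have "act s x = act t x" if "x \<in> gelems" for x
        using fun_cong [OF st(3), of x] that by simp
      then show "s = t"
        using act_inj st(1,2) by (simp add: sym_group_carrier)
    qed
    show "(\<lambda>s. restrict (act s) gelems) ` carrier (sym_group 5) = carrier (CorGroup gelems gtype ginc)"
    proof (intro equalityI subsetI)
      fix a assume "a \<in> carrier (CorGroup gelems gtype ginc)"
      then have "a \<in> correlations gelems gtype ginc"
        by (simp add: CorGroup_def)
      then obtain s where s: "s permutes {1..5}" "a = restrict (act s) gelems"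
        by (rule correlation_induced_by_permutation)
      have "s \<in> carrier (sym_group 5)"
        using s(1) unfolding sym_group_carrier .
      then show "a \<in> (\<lambda>s. restrict (act s) gelems) ` carrier (sym_group 5)"
        unfolding s(2) by (rule imageI)
    qed (auto simp: CorGroup_def sym_group_carrier restrict_act_in_correlations)
  qed
qed

text \<open>In this form, as \<open>CorGroup\<close> with a smaller carrier, the group can be
  reached by restricting an isomorphism onto \<open>CorGroup\<close>.\<close>

lemma CorGroupI_eq_act:
  "CorGroupI gelems gtype ginc = CorGroup gelems gtype ginc
     \<lparr>carrier := (\<lambda>s. restrict (act s) gelems) ` carrier (alt_group 5)\<rparr>"
proof -
  have "type_preserving_correlations gelems gtype ginc = (\<lambda>s. restrict (act s) gelems) ` carrier (alt_group 5)"
  proof (intro equalityI subsetI)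
    fix a assume "a \<in> type_preserving_correlations gelems gtype ginc"
    then have a: "a \<in> correlations gelems gtype ginc" "\<forall>x\<in>gelems. gtype (a x) = gtype x"
      by (simp_all add: type_preserving_correlations_def)
    from a(1) obtain s where s: "s permutes {1..5}" "a = restrict (act s) gelems"
      by (rule correlation_induced_by_permutation)
    have "evenperm s"
      using a(2) s(2) act_type_preserving_iff by simp
    with s(1) have "s \<in> carrier (alt_group 5)"
      unfolding alt_group_carrier by blast
    then show "a \<in> (\<lambda>s. restrict (act s) gelems) ` carrier (alt_group 5)"
      unfolding s(2) by (rule imageI)
  next
    fix a assume "a \<in> (\<lambda>s. restrict (act s) gelems) ` carrier (alt_group 5)"
    then obtain s where s: "s permutes {1..5}" "evenperm s" "a = restrict (act s) gelems"
      by (auto simp: alt_group_carrier)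
    then show "a \<in> type_preserving_correlations gelems gtype ginc"
      using restrict_act_in_correlations [OF s(1)] act_type_preserving_iff
      by (simp add: type_preserving_correlations_def)
  qed
  then show ?thesis
    by (simp add: CorGroupI_def CorGroup_def)
qed

section \<open>Automorphisms of the alternating group on five points\<close>

definition three_cycle :: "nat \<Rightarrow> nat \<Rightarrow> nat \<Rightarrow> nat \<Rightarrow> nat" where
  "three_cycle a b c = cycle_of_list [a, b, c]"

lemma three_cycle_apply:
  assumes "distinct [a,b,c]"
  shows "three_cycle a b c x = (if x = a then b else if x = b then c else if x = c then a else x)"
  using assms by (auto simp: three_cycle_def transpose_def)

lemma three_cycle_moves:
  assumes "distinct [a,b,c]" "x \<in> {a,b,c}"
  shows "three_cycle a b c x \<noteq> x"
  using assms unfolding three_cycle_apply [OF assms(1)] by auto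

lemma three_cycle_rotate:
  assumes "distinct [a,b,c]"
  shows "three_cycle b c a = three_cycle a b c"
  using assms by (auto simp: three_cycle_apply fun_eq_iff)

lemma three_cycle_conjugate:
  assumes "distinct [a,b,c]" "bij s"
  shows "s \<circ> three_cycle a b c \<circ> inv' s = three_cycle (s a) (s b) (s c)"
  using conjugation_of_cycle [OF assms] by (simp add: three_cycle_def)

lemma three_cycle_in_three_cycles:
  assumes "distinct [a,b,c]" "{a,b,c} \<subseteq> {1..n}"
  shows "three_cycle a b c \<in> three_cycles n"
  unfolding three_cycle_def using assms
  by (intro CollectI exI [of _ "[a,b,c]"]) auto

lemma three_cyclesE:
  assumes "p \<in> three_cycles n"
  obtains a b c where "distinct [a,b,c]" "{a,b,c} \<subseteq> {1..n}" "p = three_cycle a b c"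
proof -
  obtain cs where cs: "p = cycle_of_list cs" "distinct cs" "length cs = 3" "set cs \<subseteq> {1..n}"
    using assms by auto
  then obtain a b c where "cs = [a,b,c]"
    by (auto simp: length_Suc_conv eval_nat_numeral)
  with cs that show thesis
    by (auto simp: three_cycle_def)
qed

lemma three_cycle_in_alt_group:
  assumes "distinct [a,b,c]" "{a,b,c} \<subseteq> {1..n}"
  shows "three_cycle a b c \<in> carrier (alt_group n)"
  using three_cycle_in_three_cycles [OF assms] three_cycles_incl by blast

text \<open>Nontrivial orbits have three points, and five points have room for only one of
  them.\<close>

lemma order_3_imp_three_cycle:
  assumes g: "g permutes {1..5}" "g \<circ> g \<circ> g = id" "g \<noteq> id"
  obtains a b c where "distinct [a,b,c]" "{a,b,c} \<subseteq> {1..5}" "g = three_cycle a b c"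
proof -
  have g3: "g (g (g x)) = x" for x
    using fun_cong [OF g(2), of x] by simp
  have inj: "g x = g y \<longleftrightarrow> x = y" for x y
    using permutes_inj [OF g(1)] by (rule inj_eq)
  have orbit: "distinct [x, g x, g (g x)]" "{x, g x, g (g x)} \<subseteq> {1..5}" if "g x \<noteq> x" for x
  proof -
    show "distinct [x, g x, g (g x)]"
      using that inj g3 by (metis distinct_length_2_or_more distinct_singleton)
    have "x \<in> {1..5}"
      using that g(1) by (metis permutes_not_in)
    then show "{x, g x, g (g x)} \<subseteq> {1..5}"
      by (simp only: insert_subset permutes_in_image [OF g(1)] empty_subsetI simp_thms)
  qed
  obtain a where a: "g a \<noteq> a"
    using g(3) by (metis eq_id_iff)
  have fixed: "g x = x" if x: "x \<notin> {a, g a, g (g a)}" for x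
  proof (rule ccontr)
    assume "g x \<noteq> x"
    note orbits = orbit [OF this] orbit [OF a]
    have "{x, g x, g (g x)} \<inter> {a, g a, g (g a)} = {}"
      using x g3 inj by (auto; metis)
    then have "card ({x, g x, g (g x)} \<union> {a, g a, g (g a)}) = 6"
      using orbits by (subst card_Un_disjoint) auto
    moreover have "card ({x, g x, g (g x)} \<union> {a, g a, g (g a)}) \<le> card {1..5::nat}"
      using orbits(2,4) by (intro card_mono finite_atLeastAtMost Un_least)
    ultimately show False by simp
  qed
  have "g = three_cycle a (g a) (g (g a))"
  proof
    fix x show "g x = three_cycle a (g a) (g (g a)) x"
      unfolding three_cycle_apply [OF orbit(1) [OF a]] using g3 fixed [of x] by auto
  qed
  with orbit [OF a] show thesis
    by (rule that)
qed

text \<open>Lets a 3-cycle be written from any point that it moves, so that two cycles can be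
  compared at a shared point.\<close>

lemma three_cycle_from_point:
  assumes "distinct [a,b,c]" "{a,b,c} \<subseteq> {1..n}" "g = three_cycle a b c" "g x \<noteq> x"
  shows "distinct [x, g x, g (g x)]" "{x, g x, g (g x)} \<subseteq> {1..n}" "g = three_cycle x (g x) (g (g x))"
proof -
  have g: "g y = (if y = a then b else if y = b then c else if y = c then a else y)" for y
    unfolding assms(3) by (rule three_cycle_apply [OF assms(1)])
  have "x \<in> {a,b,c}"
    using g [of x] assms(4) by (auto split: if_splits)
  then consider "x = a" "g x = b" "g (g x) = c" | "x = b" "g x = c" "g (g x) = a"
    | "x = c" "g x = a" "g (g x) = b"
    using assms(1) by (auto simp: g)
  then have *: "distinct [x, g x, g (g x)] \<and> {x, g x, g (g x)} \<subseteq> {1..n} \<and>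
    three_cycle x (g x) (g (g x)) = three_cycle a b c"
    by cases (use assms(1,2) three_cycle_rotate [of a b c] three_cycle_rotate [of c a b] in simp_all)
  then show "distinct [x, g x, g (g x)]" "{x, g x, g (g x)} \<subseteq> {1..n}"
    "g = three_cycle x (g x) (g (g x))"
    using assms(3) by simp_all
qed

text \<open>Five points are too few for disjoint supports. Among the ways to overlap, only a common
  arc with different third points makes the product have order two.\<close>

lemma three_cycles_common_arc:
  assumes p: "distinct [a,b,c]" "{a,b,c} \<subseteq> {1..5}" "p = three_cycle a b c"
    and q: "distinct [d,e,f]" "{d,e,f} \<subseteq> {1..5}" "q = three_cycle d e f"
    and pq: "(p \<circ> q) \<circ> (p \<circ> q) = id" "p \<circ> q \<noteq> id"
  shows "\<exists>x. p x \<noteq> x \<and> p x = q x \<and> p (p x) \<noteq> q (q x)"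
proof -
  have "{a,b,c} \<inter> {d,e,f} \<noteq> {}"
  proof
    assume "{a,b,c} \<inter> {d,e,f} = {}"
    then have "card ({a,b,c} \<union> {d,e,f}) = 6"
      using p(1) q(1) by (subst card_Un_disjoint) auto
    moreover have "card ({a,b,c} \<union> {d,e,f}) \<le> card {1..5::nat}"
      using p(2) q(2) by (intro card_mono finite_atLeastAtMost Un_least)
    ultimately show False by simp
  qed
  then obtain x where x: "x \<in> {a,b,c}" "x \<in> {d,e,f}" by blast
  have "p x \<noteq> x" "q x \<noteq> x"
    using three_cycle_moves [OF p(1) x(1)] three_cycle_moves [OF q(1) x(2)] p(3) q(3) by simp_all
  note P = three_cycle_from_point [where g = p and x = x, OF p this(1)]
    and Q = three_cycle_from_point [where g = q and x = x, OF q this(2)]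
  define b' c' e' f' where "b' = p x" and "c' = p (p x)" and "e' = q x" and "f' = q (q x)"
  have p': "distinct [x,b',c']" "p = three_cycle x b' c'" and q': "distinct [x,e',f']" "q = three_cycle x e' f'"
    using P Q by (simp_all add: b'_def c'_def e'_def f'_def)
  have pv: "p y = (if y = x then b' else if y = b' then c' else if y = c' then x else y)"
    and qv: "q y = (if y = x then e' else if y = e' then f' else if y = f' then x else y)" for y
    using three_cycle_apply [OF p'(1)] three_cycle_apply [OF q'(1)] p'(2) q'(2) by auto
  have inv: "p (q (p (q y))) = y" for y
    using fun_cong [OF pq(1), of y] by simp
  \<comment> \<open>In the first two cases the common arc leaves or enters \<open>x\<close>; equal
    cycles are excluded by the order of the product. In the third, \<open>q\<close> is the inverse
    of \<open>p\<close>. In the fourth and fifth, a shared pair is traversed in opposite directions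
    and the product is a 3-cycle. In the last, only \<open>x\<close> is shared and the product is a
    5-cycle.\<close>
  consider "e' = b'" | "e' \<noteq> b'" "f' = c'" | "e' = c'" "f' = b'" | "e' = c'" "f' \<noteq> b'" "f' \<noteq> c'"
    | "e' \<noteq> b'" "e' \<noteq> c'" "f' = b'" | "e' \<noteq> b'" "e' \<noteq> c'" "f' \<noteq> b'" "f' \<noteq> c'"
    by blast
  then show ?thesis
  proof cases
    case 1
    then show ?thesis
      using inv [of x] p'(1) q'(1) by (intro exI [of _ x]) (auto simp: pv qv split: if_splits)
  next
    case 2
    then show ?thesis
      using p'(1) q'(1) by (intro exI [of _ c']) (auto simp: pv qv)
  next
    case 3
    then have "(p \<circ> q) y = id y" for y
      using p'(1) by (auto simp: pv qv)
    then show ?thesis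
      using pq(2) by blast
  next
    case 4
    then show ?thesis
      using inv [of c'] p'(1) q'(1) by (auto simp: pv qv split: if_splits)
  next
    case 5
    then show ?thesis
      using inv [of x] p'(1) q'(1) by (auto simp: pv qv split: if_splits)
  next
    case 6
    then show ?thesis
      using inv [of x] p'(1) q'(1) by (auto simp: pv qv split: if_splits)
  qed
qed

text \<open>Let \<open>p\<close> and \<open>q\<close> share the arc from \<open>u\<close> to
  \<open>v\<close>. If \<open>r\<close> missed it, \<open>r\<close> would contain another arc of
  \<open>p\<close> and another arc of \<open>q\<close>; these have the same start, the same end, or
  four points in all, which is impossible in a 3-cycle.\<close>

lemma three_cycles_through_common_arc:
  assumes p: "distinct [a,b,c]" "{a,b,c} \<subseteq> {1..5}" "p = three_cycle a b c"
    and q: "distinct [a',b',c']" "{a',b',c'} \<subseteq> {1..5}" "q = three_cycle a' b' c'"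
    and r: "distinct [a'',b'',c'']" "{a'',b'',c''} \<subseteq> {1..5}" "r = three_cycle a'' b'' c''"
    and pq: "(p \<circ> q) \<circ> (p \<circ> q) = id" "p \<circ> q \<noteq> id"
    and pr: "(p \<circ> r) \<circ> (p \<circ> r) = id" "p \<circ> r \<noteq> id"
    and qr: "(q \<circ> r) \<circ> (q \<circ> r) = id" "q \<circ> r \<noteq> id"
  obtains u v w1 w2 w3 where "distinct [u,v,w1,w2,w3]" "{u,v,w1,w2,w3} \<subseteq> {1..5}"
    "p = three_cycle u v w1" "q = three_cycle u v w2" "r = three_cycle u v w3"
proof -
  obtain u where u: "p u \<noteq> u" "q u = p u" "p (p u) \<noteq> q (q u)"
    using three_cycles_common_arc [OF p q pq] by metis
  obtain x where x: "p x \<noteq> x" "r x = p x" "p (p x) \<noteq> r (r x)"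
    using three_cycles_common_arc [OF p r pr] by metis
  obtain y where y: "q y \<noteq> y" "r y = q y" "q (q y) \<noteq> r (r y)"
    using three_cycles_common_arc [OF q r qr] by metis
  define v w1 w2 where "v = p u" and "w1 = p v" and "w2 = q v"
  note P = three_cycle_from_point [where g = p and x = u, OF p u(1), folded v_def, folded w1_def]
  have "q u \<noteq> u"
    using u by simp
  note Q = three_cycle_from_point [where g = q and x = u, OF q this, unfolded u(2), folded v_def, folded w2_def]
  have "w1 \<noteq> w2"
    using u(2,3) by (simp add: v_def w1_def w2_def)
  have pv: "p z = (if z = u then v else if z = v then w1 else if z = w1 then u else z)"
    and qv: "q z = (if z = u then v else if z = v then w2 else if z = w2 then u else z)" for z
    using three_cycle_apply [OF P(1)] three_cycle_apply [OF Q(1)] P(3) Q(3) by auto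
  have "r u = v"
  proof (rule ccontr)
    assume "r u \<noteq> v"
    then have xy: "x = v \<or> x = w1" "y = v \<or> y = w2"
      using x(1,2) y(1,2) by (auto simp: pv qv split: if_splits)
    have "r x \<noteq> x"
      using x by simp
    note X = three_cycle_from_point [where g = r and x = x, OF r this]
    have "r y \<noteq> y"
      using y by simp
    \<comment> \<open>\<open>r\<close> moves only three points; the last alternative stands for
      \<open>y = r (r x)\<close>.\<close>
    then have "y = x \<or> y = r x \<or> r y = x"
      using three_cycle_apply [OF X(1), of y] X(3) by (metis (full_types))
    moreover have "x = v \<and> r x = w1 \<or> x = w1 \<and> r x = u" "y = v \<and> r y = w2 \<or> y = w2 \<and> r y = u"
      using xy x(2) y(2) P(1) Q(1) by (auto simp: pv qv)
    ultimately show False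
      using P(1) Q(1) \<open>w1 \<noteq> w2\<close> by auto
  qed
  have "r u \<noteq> u"
    using \<open>r u = v\<close> P(1) by auto
  note R = three_cycle_from_point [where g = r and x = u, OF r this, unfolded \<open>r u = v\<close>]
  have "r v \<noteq> w1"
  proof
    assume "r v = w1"
    then have "r = p"
      using R(3) P(3) by simp
    with x(3) show False by simp
  qed
  moreover have "r v \<noteq> w2"
  proof
    assume "r v = w2"
    then have "r = q"
      using R(3) Q(3) by simp
    with y(3) show False by simp
  qed
  ultimately show thesis
    using that [of u v w1 w2 "r v"] P Q R \<open>w1 \<noteq> w2\<close> by auto
qed

lemma three_cycle_square:
  assumes "distinct [a,b,c]"
  shows "three_cycle a b c \<circ> three_cycle a b c = three_cycle a c b"
proof
  have "distinct [a,c,b]"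
    using assms by auto
  then show "(three_cycle a b c \<circ> three_cycle a b c) x = three_cycle a c b x" for x
    using assms by (simp add: three_cycle_apply)
qed

lemma three_cycle_cube:
  assumes "distinct [a,b,c]"
  shows "three_cycle a b c \<circ> three_cycle a b c \<circ> three_cycle a b c = id"
  by (rule ext) (use assms in \<open>auto simp: three_cycle_apply\<close>)

text \<open>The product is the double transposition exchanging \<open>a\<close> with
  \<open>c\<close> and \<open>b\<close> with \<open>d\<close>.\<close>

lemma three_cycles_product_involution:
  assumes "distinct [a,b,c,d]"
  shows "(three_cycle a b c \<circ> three_cycle a b d) \<circ> (three_cycle a b c \<circ> three_cycle a b d) = id"
    and "three_cycle a b c \<circ> three_cycle a b d \<noteq> id"
proof -
  have d: "distinct [a,b,c]" "distinct [a,b,d]"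
    using assms by auto
  note vals = three_cycle_apply [OF d(1)] three_cycle_apply [OF d(2)]
  show "(three_cycle a b c \<circ> three_cycle a b d) \<circ> (three_cycle a b c \<circ> three_cycle a b d) = id"
    by (rule ext) (use assms in \<open>auto simp: vals\<close>)
  have "(three_cycle a b c \<circ> three_cycle a b d) a \<noteq> a"
    using assms by (auto simp: vals)
  then show "three_cycle a b c \<circ> three_cycle a b d \<noteq> id"
    by (metis id_apply)
qed

section \<open>Generators and automorphisms of the alternating group\<close>

lemma (in group) hom_eq_on_generate:
  assumes "group H" "f \<in> hom G H" "h \<in> hom G H" "S \<subseteq> carrier G"
    and eq: "\<And>x. x \<in> S \<Longrightarrow> f x = h x" and x: "x \<in> generate G S"
  shows "f x = h x"
proof -
  interpret f: group_hom G H f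
    using assms by (simp add: group_hom_def group_hom_axioms_def is_group)
  interpret h: group_hom G H h
    using assms by (simp add: group_hom_def group_hom_axioms_def is_group)
  show ?thesis
    using x
  proof (induction rule: generate.induct)
    case (eng x y)
    then show ?case
      using generate_in_carrier [OF assms(4)] by simp
  qed (use eq assms(4) in auto)
qed

text \<open>Squaring and conjugating the three generators yields all 3-cycles, and these generate
  the alternating group.\<close>

lemma alt_group_5_generators:
  "carrier (alt_group 5) =
     generate (alt_group 5) {three_cycle 1 2 3, three_cycle 1 2 4, three_cycle 1 2 5}"
  (is "_ = ?K")
proof
  interpret A: group "alt_group 5"
    by (rule alt_group_is_group)
  have sub: "{three_cycle 1 2 3, three_cycle 1 2 4, three_cycle 1 2 5} \<subseteq> carrier (alt_group 5)"
    by (simp add: three_cycle_in_alt_group)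
  then interpret K: subgroup ?K "alt_group 5"
    by (rule A.generate_is_subgroup)
  show "?K \<subseteq> carrier (alt_group 5)"
    by (rule K.subset)
  have comp: "g \<circ> h \<in> ?K" if "g \<in> ?K" "h \<in> ?K" for g h
    using K.m_closed [OF that] by (simp add: alt_group_mult)
  \<comment> \<open>A subgroup is closed under conjugation by its own elements, and conjugation
    relabels the points of a 3-cycle.\<close>
  have conj: "three_cycle (g a) (g b) (g c) \<in> ?K"
    if "g \<in> ?K" "three_cycle a b c \<in> ?K" "distinct [a,b,c]" for g a b c
  proof -
    have "g \<in> carrier (alt_group 5)"
      using that(1) K.subset by blast
    then have g: "bij g" "inv' g \<in> ?K"
      using K.m_inv_closed [OF that(1)]
      by (auto simp: alt_group_inv_equality alt_group_carrier permutes_bij)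
    show ?thesis
      using comp [OF comp [OF that(1,2)] g(2)] unfolding three_cycle_conjugate [OF that(3) g(1)] .
  qed
  have T: "three_cycle 1 2 i \<in> ?K" if "i \<in> {3,4,5}" for i
    using that by (auto intro: generate.incl)
  have U: "three_cycle 1 i 2 \<in> ?K" if "i \<in> {3,4,5}" for i
    using comp [OF T [OF that] T [OF that]] three_cycle_square [of 1 2 i] that by auto
  have c1: "three_cycle 2 j i \<in> ?K" if "i \<in> {3,4,5}" "j \<in> {3,4,5}" "i \<noteq> j" for i j
  proof -
    have d: "distinct [1,2,i]" "distinct [1,2,j]"
      using that by auto
    have "three_cycle 1 2 j 1 = 2" "three_cycle 1 2 j 2 = j" "three_cycle 1 2 j i = i"
      unfolding three_cycle_apply [OF d(2)] using that by auto
    with conj [OF T [OF that(2)] T [OF that(1)] d(1)] show ?thesis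
      by (simp only:)
  qed
  have c2: "three_cycle 1 i j \<in> ?K" if "i \<in> {3,4,5}" "j \<in> {3,4,5}" "i \<noteq> j" for i j
  proof -
    have d: "distinct [1,2,i]" "distinct [1,j,2]" "distinct [j,1,i]"
      using that by auto
    have "three_cycle 1 j 2 1 = j" "three_cycle 1 j 2 2 = 1" "three_cycle 1 j 2 i = i"
      unfolding three_cycle_apply [OF d(2)] using that by auto
    with conj [OF U [OF that(2)] T [OF that(1)] d(1)] show ?thesis
      by (simp only: three_cycle_rotate [OF d(3)])
  qed
  have c3: "three_cycle k j i \<in> ?K"
    if "i \<in> {3,4,5}" "j \<in> {3,4,5}" "k \<in> {3,4,5}" "distinct [i,j,k]" for i j k
  proof -
    have d: "distinct [2,j,i]" "distinct [1,2,k]" "i \<noteq> j"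
      using that by auto
    have "three_cycle 1 2 k 2 = k" "three_cycle 1 2 k j = j" "three_cycle 1 2 k i = i"
      unfolding three_cycle_apply [OF d(2)] using that by auto
    with conj [OF T [OF that(3)] c1 [OF that(1,2) d(3)] d(1)] show ?thesis
      by (simp only:)
  qed
  \<comment> \<open>Brings the least point to the front; what remains are the forms covered by
    \<open>T\<close>, \<open>U\<close>, \<open>c1\<close>, \<open>c2\<close> and
    \<open>c3\<close>.\<close>
  have rot: "three_cycle b c a = three_cycle a b c" "three_cycle c a b = three_cycle a b c"
    if "a < b" "a < c" "b \<noteq> c" for a b c
    using three_cycle_rotate [of a b c] three_cycle_rotate [of c a b] that by auto
  have all: "a \<in> {1,2,3,4,5} \<Longrightarrow> b \<in> {1,2,3,4,5} \<Longrightarrow> c \<in> {1,2,3,4,5} \<Longrightarrow> distinct [a,b,c] \<Longrightarrow>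
    three_cycle a b c \<in> ?K" for a b c
    by (elim insertE emptyE) (hypsubst, simp add: T U c1 c2 c3 rot del: One_nat_def)+
  have "three_cycles 5 \<subseteq> ?K"
  proof
    fix p assume "p \<in> three_cycles 5"
    then obtain a b c where "distinct [a,b,c]" "{a,b,c} \<subseteq> {1..5}" "p = three_cycle a b c"
      by (rule three_cyclesE)
    then show "p \<in> ?K"
      using all [of a b c] unfolding atLeastAtMost_1_5 by simp
  qed
  then show "carrier (alt_group 5) \<subseteq> ?K"
    using A.generate_subgroup_incl [OF _ K.subgroup_axioms]
    unfolding alt_group_carrier_as_three_cycles by blast
qed

lemma alt_group_5_automorphism_inner_in_sym:
  assumes hom: "\<alpha> \<in> hom (alt_group 5) (alt_group 5)" and inj: "inj_on \<alpha> (carrier (alt_group 5))"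
  obtains s where "s permutes {1..5}" "\<And>g. g \<in> carrier (alt_group 5) \<Longrightarrow> \<alpha> g = s \<circ> g \<circ> inv' s"
proof -
  let ?A = "carrier (alt_group 5)"
  interpret A: group "alt_group 5"
    by (rule alt_group_is_group)
  have closed: "\<alpha> g \<in> ?A" if "g \<in> ?A" for g
    using hom that by (auto simp: hom_def)
  have mult: "\<alpha> (g \<circ> h) = \<alpha> g \<circ> \<alpha> h" if "g \<in> ?A" "h \<in> ?A" for g h
    using hom_mult [OF hom that] by (simp add: alt_group_mult)
  have comp: "g \<circ> h \<in> ?A" if "g \<in> ?A" "h \<in> ?A" for g h
    using A.m_closed [OF that] by (simp add: alt_group_mult)
  have id: "id \<in> ?A"
    using A.one_closed by (simp add: alt_group_one)
  have one: "\<alpha> id = id"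
    using hom_one [OF hom alt_group_is_group alt_group_is_group] by (simp add: alt_group_one)
  have eq_id: "\<alpha> g = id \<longleftrightarrow> g = id" if "g \<in> ?A" for g
    using inj_onD [OF inj, of g id] one id that by auto
  define x where "x i = three_cycle 1 2 i" for i
  have xd: "distinct [1,2,i]" if "i \<in> {3,4,5}" for i :: nat
    using that by auto
  have xA: "x i \<in> ?A" if "i \<in> {3,4,5}" for i
    unfolding x_def by (rule three_cycle_in_alt_group [OF xd [OF that]]) (use that in auto)
  \<comment> \<open>Injectivity keeps the order three of \<open>x i\<close>, so the image is again a
    3-cycle.\<close>
  have "\<exists>a b c. distinct [a,b,c] \<and> {a,b,c} \<subseteq> {1..5} \<and> \<alpha> (x i) = three_cycle a b c"
    if i: "i \<in> {3,4,5}" for i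
  proof -
    have "\<alpha> (x i) \<circ> \<alpha> (x i) \<circ> \<alpha> (x i) = \<alpha> (x i \<circ> x i \<circ> x i)"
      using xA [OF i] by (simp add: mult comp)
    also have "\<dots> = id"
      using three_cycle_cube [OF xd [OF i]] by (simp add: x_def one)
    finally have "\<alpha> (x i) \<circ> \<alpha> (x i) \<circ> \<alpha> (x i) = id" .
    moreover have "x i \<noteq> id"
      using three_cycle_moves [OF xd [OF i], of 1] by (auto simp: x_def)
    moreover have "\<alpha> (x i) permutes {1..5}"
      using closed [OF xA [OF i]] by (simp add: alt_group_carrier)
    ultimately show ?thesis
      using eq_id [OF xA [OF i]] by (metis order_3_imp_three_cycle)
  qed
  then obtain a b c where "\<And>i. i \<in> {3,4,5} \<Longrightarrow>
      distinct [a i, b i, c i] \<and> {a i, b i, c i} \<subseteq> {1..5} \<and> \<alpha> (x i) = three_cycle (a i) (b i) (c i)"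
    by metis
  then have abc: "\<And>i. i \<in> {3,4,5} \<Longrightarrow> distinct [a i, b i, c i]"
    "\<And>i. i \<in> {3,4,5} \<Longrightarrow> {a i, b i, c i} \<subseteq> {1..5}"
    "\<And>i. i \<in> {3,4,5} \<Longrightarrow> \<alpha> (x i) = three_cycle (a i) (b i) (c i)"
    by blast+
  \<comment> \<open>\<open>\<alpha>\<close> carries the involutive products of the generators over
    to their images, which is the hypothesis for a common arc.\<close>
  have prod: "(\<alpha> (x i) \<circ> \<alpha> (x j)) \<circ> (\<alpha> (x i) \<circ> \<alpha> (x j)) = id" "\<alpha> (x i) \<circ> \<alpha> (x j) \<noteq> id"
    if ij: "i \<in> {3,4,5}" "j \<in> {3,4,5}" "i \<noteq> j" for i j
  proof -
    have "distinct [1,2,i,j]"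
      using ij by auto
    from three_cycles_product_involution [OF this, folded x_def]
    have "\<alpha> ((x i \<circ> x j) \<circ> (x i \<circ> x j)) = id" "\<alpha> (x i \<circ> x j) \<noteq> id"
      using xA ij by (simp_all only: one eq_id comp not_False_eq_True)
    then show "(\<alpha> (x i) \<circ> \<alpha> (x j)) \<circ> (\<alpha> (x i) \<circ> \<alpha> (x j)) = id" "\<alpha> (x i) \<circ> \<alpha> (x j) \<noteq> id"
      using xA ij by (simp_all only: mult comp not_False_eq_True)
  qed
  obtain u v w3 w4 w5 where uv: "distinct [u,v,w3,w4,w5]" "{u,v,w3,w4,w5} \<subseteq> {1..5}"
    "\<alpha> (x 3) = three_cycle u v w3" "\<alpha> (x 4) = three_cycle u v w4" "\<alpha> (x 5) = three_cycle u v w5"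
  proof (rule three_cycles_through_common_arc)
    show "distinct [a 3, b 3, c 3]" "{a 3, b 3, c 3} \<subseteq> {1..5}"
      "\<alpha> (x 3) = three_cycle (a 3) (b 3) (c 3)"
      by (rule abc; simp)+
    show "distinct [a 4, b 4, c 4]" "{a 4, b 4, c 4} \<subseteq> {1..5}"
      "\<alpha> (x 4) = three_cycle (a 4) (b 4) (c 4)"
      by (rule abc; simp)+
    show "distinct [a 5, b 5, c 5]" "{a 5, b 5, c 5} \<subseteq> {1..5}"
      "\<alpha> (x 5) = three_cycle (a 5) (b 5) (c 5)"
      by (rule abc; simp)+
  qed (use prod [of 3 4] prod [of 3 5] prod [of 4 5] in simp_all)
  \<comment> \<open>\<open>s\<close> is chosen so that conjugation by it agrees with
    \<open>\<alpha>\<close> on the generators.\<close>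
  obtain s where s: "s permutes {1..5}" "s 1 = u" "s 2 = v" "s 3 = w3" "s 4 = w4" "s 5 = w5"
    using permutation_with_values [OF uv(1,2)] by blast
  have bij: "bij s"
    using s(1) by (rule permutes_bij)
  have on_gens: "\<alpha> (x i) = s \<circ> x i \<circ> inv' s" if "i \<in> {3,4,5}" for i
    unfolding x_def three_cycle_conjugate [OF xd [OF that] bij]
    using that uv s by (auto simp: x_def)
  \<comment> \<open>The two maps are compared in the symmetric group, where conjugation by a
    possibly odd \<open>s\<close> needs no parity argument.\<close>
  have hom1: "\<alpha> \<in> hom (alt_group 5) (sym_group 5)"
    using closed mult by (auto simp: hom_def sym_group_mult alt_group_mult alt_group_carrier sym_group_carrier)
  have hom2: "(\<lambda>g. s \<circ> g \<circ> inv' s) \<in> hom (alt_group 5) (sym_group 5)"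
  proof (rule homI)
    fix g h assume gh: "g \<in> ?A" "h \<in> ?A"
    show "s \<circ> g \<circ> inv' s \<in> carrier (sym_group 5)"
      using gh s(1) by (simp add: sym_group_carrier alt_group_carrier permutes_compose permutes_inv)
    have "inv' s \<circ> s = id"
      using s(1) by (rule permutes_inv_o)
    then show "s \<circ> (g \<otimes>\<^bsub>alt_group 5\<^esub> h) \<circ> inv' s =
      (s \<circ> g \<circ> inv' s) \<otimes>\<^bsub>sym_group 5\<^esub> (s \<circ> h \<circ> inv' s)"
      unfolding alt_group_mult sym_group_mult by (metis (no_types) comp_assoc comp_id)
  qed
  have "\<alpha> g = s \<circ> g \<circ> inv' s" if "g \<in> ?A" for g
  proof (rule A.hom_eq_on_generate [OF sym_group_is_group hom1 hom2])
    show "g \<in> generate (alt_group 5) {three_cycle 1 2 3, three_cycle 1 2 4, three_cycle 1 2 5}"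
      using that alt_group_5_generators by simp
    show "{three_cycle 1 2 3, three_cycle 1 2 4, three_cycle 1 2 5} \<subseteq> ?A"
      using xA unfolding x_def by auto
    show "\<alpha> y = s \<circ> y \<circ> inv' s" if "y \<in> {three_cycle 1 2 3, three_cycle 1 2 4, three_cycle 1 2 5}" for y
      using that on_gens [of 3] on_gens [of 4] on_gens [of 5] unfolding x_def by auto
  qed
  with s(1) show thesis
    by (rule that)
qed

text \<open>If \<open>s\<close> moves \<open>a\<close>, it cannot commute with a 3-cycle that moves
  \<open>a\<close> but fixes \<open>s a\<close>.\<close>

lemma centralizer_of_alt_group_trivial:
  assumes s: "s permutes {1..5}"
    and comm: "\<And>g. g \<in> carrier (alt_group 5) \<Longrightarrow> s \<circ> g = g \<circ> s"
  shows "s = id"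
proof (rule ccontr)
  assume "s \<noteq> id"
  then obtain a where a: "s a \<noteq> a"
    by (metis eq_id_iff)
  have mem: "a \<in> {1..5}" "s a \<in> {1..5}"
    using a s by (metis permutes_not_in, metis permutes_in_image permutes_not_in)
  have "card ({1..5} - {a, s a}) = 3"
    using a mem by (simp add: card_Diff_subset)
  then obtain c d e where cde: "{1..5} - {a, s a} = {c,d,e}" "c \<noteq> d"
    by (auto simp: card_3_iff)
  then have cd: "c \<in> {1..5} - {a, s a}" "d \<in> {1..5} - {a, s a}"
    by auto
  have dist: "distinct [a,c,d]"
    using cd cde(2) by auto
  have "three_cycle a c d \<in> carrier (alt_group 5)"
    by (rule three_cycle_in_alt_group [OF dist]) (use mem cd in auto)
  from fun_cong [OF comm [OF this], of a] have "s c = s a"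
    using a cd by (auto simp: three_cycle_apply [OF dist])
  then show False
    using permutes_inj [OF s] dist by (auto dest: injD)
qed

section \<open>Automorphisms of the direct product\<close>

abbreviation (input) A5_times_C2 :: "((nat \<Rightarrow> nat) \<times> int) monoid" where
  "A5_times_C2 \<equiv> alt_group 5 \<times>\<times> integer_mod_group 2"

text \<open>\<open>restrict\<close> makes the map extensional, as \<open>auto\<close> requires. Odd
  \<open>s\<close> will account for the automorphisms that are not inner.\<close>

definition conj_aut :: "(nat \<Rightarrow> nat) \<Rightarrow> (nat \<Rightarrow> nat) \<times> int \<Rightarrow> (nat \<Rightarrow> nat) \<times> int" where
  "conj_aut s = restrict (\<lambda>(g, c). (s \<circ> g \<circ> inv' s, c)) (carrier A5_times_C2)"

lemma carrier_C2: "carrier (integer_mod_group 2) = {0, 1}"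
  by (auto simp: carrier_integer_mod_group)

lemma carrier_A5_times_C2: "carrier A5_times_C2 = carrier (alt_group 5) \<times> {0, 1}"
  unfolding DirProd_def by (simp add: carrier_C2)

lemma mult_A5_times_C2: "(g, c) \<otimes>\<^bsub>A5_times_C2\<^esub> (h, d) = (g \<circ> h, (c + d) mod 2)"
  by (simp add: alt_group_mult)

lemma alt_group_conjugate:
  assumes s: "s permutes {1..n}" and g: "g \<in> carrier (alt_group n)"
  shows "s \<circ> g \<circ> inv' s \<in> carrier (alt_group n)"
proof -
  have inv: "inv' s permutes {1..n}"
    using s by (rule permutes_inv)
  have perm: "permutation s" "permutation g" "permutation (inv' s)"
    using s inv g by (auto simp: permutation_permutes alt_group_carrier)
  have "evenperm (s \<circ> g \<circ> inv' s)"
    using g by (simp add: evenperm_comp perm permutation_compose evenperm_inv alt_group_carrier)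
  then show ?thesis
    using g s inv by (simp add: alt_group_carrier permutes_compose)
qed

lemma conj_aut_apply:
  "g \<in> carrier (alt_group 5) \<Longrightarrow> c \<in> {0, 1} \<Longrightarrow> conj_aut s (g, c) = (s \<circ> g \<circ> inv' s, c)"
  by (simp add: conj_aut_def carrier_C2)

lemma conj_aut_closed:
  assumes "s permutes {1..5}" "x \<in> carrier A5_times_C2"
  shows "conj_aut s x \<in> carrier A5_times_C2"
proof -
  obtain g c where x: "x = (g, c)" "g \<in> carrier (alt_group 5)" "c \<in> {0, 1}"
    using assms(2) by (auto simp: carrier_C2)
  then show ?thesis
    using alt_group_conjugate [OF assms(1) x(2)] conj_aut_apply [OF x(2,3)]
    by (simp add: carrier_C2)
qed

lemma conj_aut_comp:
  assumes s: "s permutes {1..5}" and t: "t permutes {1..5}" and x: "x \<in> carrier A5_times_C2"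
  shows "conj_aut (s \<circ> t) x = conj_aut s (conj_aut t x)"
proof -
  obtain g c where gc: "x = (g, c)" "g \<in> carrier (alt_group 5)" "c \<in> {0, 1}"
    using x by (auto simp: carrier_C2)
  have "inv' (s \<circ> t) = inv' t \<circ> inv' s"
    using s t by (intro o_inv_distrib permutes_bij)
  then show ?thesis
    using gc alt_group_conjugate [OF t gc(2)] by (simp add: conj_aut_apply comp_assoc)
qed

lemma conj_aut_id: "x \<in> carrier A5_times_C2 \<Longrightarrow> conj_aut id x = x"
  by (auto simp: carrier_C2 conj_aut_apply)

lemma conj_aut_in_auto:
  assumes s: "s permutes {1..5}"
  shows "conj_aut s \<in> auto A5_times_C2"
proof -
  have inv: "inv' s permutes {1..5}"
    using s by (rule permutes_inv)
  have "conj_aut s \<in> hom A5_times_C2 A5_times_C2"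
  proof (rule homI)
    fix x y assume xy: "x \<in> carrier A5_times_C2" "y \<in> carrier A5_times_C2"
    show "conj_aut s x \<in> carrier A5_times_C2"
      using conj_aut_closed [OF s xy(1)] .
    obtain g c h d where gh: "x = (g, c)" "g \<in> carrier (alt_group 5)" "c \<in> {0, 1}"
      "y = (h, d)" "h \<in> carrier (alt_group 5)" "d \<in> {0, 1}"
      using xy by (auto simp: carrier_C2)
    have "g \<circ> h \<in> carrier (alt_group 5)"
      using monoid.m_closed [OF group.is_monoid [OF alt_group_is_group] gh(2,5)]
      by (simp add: alt_group_mult)
    moreover have "(c + d) mod 2 \<in> {0, 1}"
      using gh(3,6) by auto
    moreover have "s \<circ> (g \<circ> h) \<circ> inv' s = (s \<circ> g \<circ> inv' s) \<circ> (s \<circ> h \<circ> inv' s)"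
      using permutes_inv_o(2) [OF s] by (metis (no_types) comp_assoc comp_id)
    ultimately show "conj_aut s (x \<otimes>\<^bsub>A5_times_C2\<^esub> y) = conj_aut s x \<otimes>\<^bsub>A5_times_C2\<^esub> conj_aut s y"
      unfolding gh(1,4) mult_A5_times_C2
      by (simp only: conj_aut_apply [OF gh(2,3)] conj_aut_apply [OF gh(5,6)] conj_aut_apply mult_A5_times_C2)
  qed
  moreover have "bij_betw (conj_aut s) (carrier A5_times_C2) (carrier A5_times_C2)"
  proof (rule bij_betwI [where g = "conj_aut (inv' s)"])
    show "conj_aut s \<in> carrier A5_times_C2 \<rightarrow> carrier A5_times_C2"
      "conj_aut (inv' s) \<in> carrier A5_times_C2 \<rightarrow> carrier A5_times_C2"
      using conj_aut_closed [OF s] conj_aut_closed [OF inv] by blast+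
    fix x assume x: "x \<in> carrier A5_times_C2"
    show "conj_aut (inv' s) (conj_aut s x) = x"
      using conj_aut_comp [OF inv s x] conj_aut_id [OF x] permutes_inv_o(2) [OF s] by simp
    show "conj_aut s (conj_aut (inv' s) x) = x"
      using conj_aut_comp [OF s inv x] conj_aut_id [OF x] permutes_inv_o(1) [OF s] by simp
  qed
  ultimately show ?thesis
    by (simp add: auto_def Bij_def conj_aut_def)
qed

text \<open>Equal conjugations make \<open>inv' t \<circ> s\<close> centralize the alternating
  group.\<close>

lemma conj_aut_inj:
  assumes s: "s permutes {1..5}" and t: "t permutes {1..5}" and eq: "conj_aut s = conj_aut t"
  shows "s = t"
proof -
  have si: "inv' s \<circ> s = id" "s \<circ> inv' s = id" and ti: "inv' t \<circ> t = id" "t \<circ> inv' t = id"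
    using permutes_inv_o [OF s] permutes_inv_o [OF t] by auto
  have "inv' t \<circ> s = id"
  proof (rule centralizer_of_alt_group_trivial)
    show "inv' t \<circ> s permutes {1..5}"
      using s t by (simp add: permutes_compose permutes_inv)
    fix g assume g: "g \<in> carrier (alt_group 5)"
    have "s \<circ> g \<circ> inv' s = t \<circ> g \<circ> inv' t"
      using fun_cong [OF eq, of "(g, 0)"] g by (simp add: conj_aut_apply)
    then have "inv' t \<circ> (s \<circ> g \<circ> inv' s) \<circ> s = inv' t \<circ> (t \<circ> g \<circ> inv' t) \<circ> s"
      by simp
    then show "inv' t \<circ> s \<circ> g = g \<circ> (inv' t \<circ> s)"
      using si ti by (metis (no_types) comp_assoc comp_id id_comp)
  qed
  then have "t \<circ> (inv' t \<circ> s) = t"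
    by simp
  then show ?thesis
    using ti by (metis (no_types) comp_assoc id_comp)
qed

text \<open>The cube of a 3-cycle is the identity, so its image in a group of order two is trivial;
  and the 3-cycles generate.\<close>

lemma hom_alt_group_C2_trivial:
  assumes "b \<in> hom (alt_group 5) (integer_mod_group 2)" "g \<in> carrier (alt_group 5)"
  shows "b g = 0"
proof -
  interpret A: group "alt_group 5"
    by (rule alt_group_is_group)
  have zero: "(\<lambda>_. 0) \<in> hom (alt_group 5) (integer_mod_group 2)"
    by (simp add: hom_def)
  have on_cycles: "b x = 0" if "x \<in> three_cycles 5" for x
  proof -
    obtain p q r where x: "distinct [p,q,r]" "{p,q,r} \<subseteq> {1..5}" "x = three_cycle p q r"
      using \<open>x \<in> three_cycles 5\<close> by (rule three_cyclesE)
    have xA: "x \<in> carrier (alt_group 5)"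
      using that three_cycles_incl by blast
    then have "x \<circ> x \<in> carrier (alt_group 5)"
      using A.m_closed [OF xA xA] by (simp add: alt_group_mult)
    then have "b (x \<circ> x \<circ> x) = (b (x \<circ> x) + b x) mod 2" "b (x \<circ> x) = (b x + b x) mod 2"
      using hom_mult [OF assms(1) _ xA] xA by (simp_all add: alt_group_mult)
    moreover have "b (x \<circ> x \<circ> x) = 0"
      using hom_one [OF assms(1) alt_group_is_group group_integer_mod_group] three_cycle_cube [OF x(1)] x(3)
      by (simp add: alt_group_one)
    moreover have "b x \<in> {0, 1}"
      using hom_in_carrier [OF assms(1) xA] by (simp only: carrier_C2)
    ultimately show ?thesis
      by auto
  qed
  show ?thesis
  proof (rule A.hom_eq_on_generate [OF group_integer_mod_group assms(1) zero three_cycles_incl])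
    show "g \<in> generate (alt_group 5) (three_cycles 5)"
      using assms(2) alt_group_carrier_as_three_cycles by blast
  qed (rule on_cycles)
qed

lemma automorphism_is_conj_aut:
  assumes f: "f \<in> auto A5_times_C2"
  obtains s where "s permutes {1..5}" "f = conj_aut s"
proof -
  let ?A = "carrier (alt_group 5)"
  interpret A: group "alt_group 5"
    by (rule alt_group_is_group)
  have hom: "f \<in> hom A5_times_C2 A5_times_C2" and inj: "inj_on f (carrier A5_times_C2)"
    and ext: "f \<in> extensional (carrier A5_times_C2)"
    using f by (auto simp: auto_def Bij_def bij_betw_def)
  have closed: "f (g, c) \<in> ?A \<times> {0, 1}" if "g \<in> ?A" "c \<in> {0, 1}" for g c
    using hom_in_carrier [OF hom, of "(g, c)"] that unfolding carrier_A5_times_C2 by blast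
  have mult: "f (g \<circ> h, (c + d) mod 2) =
      (fst (f (g, c)) \<circ> fst (f (h, d)), (snd (f (g, c)) + snd (f (h, d))) mod 2)"
    if "g \<in> ?A" "h \<in> ?A" "c \<in> {0, 1}" "d \<in> {0, 1}" for g h c d
  proof -
    have "f ((g, c) \<otimes>\<^bsub>A5_times_C2\<^esub> (h, d)) = f (g, c) \<otimes>\<^bsub>A5_times_C2\<^esub> f (h, d)"
      using that by (intro hom_mult [OF hom]) (auto simp: carrier_C2)
    then show ?thesis
      unfolding mult_A5_times_C2
      by (cases "f (g, c)"; cases "f (h, d)") (simp only: mult_A5_times_C2 fst_conv snd_conv)
  qed
  have id: "id \<in> ?A"
    using A.one_closed by (simp add: alt_group_one)
  \<comment> \<open>The components of \<open>f\<close> on the alternating factor; once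
    \<open>\<beta>\<close> vanishes, this factor is mapped into itself.\<close>
  define \<alpha> where "\<alpha> g = fst (f (g, 0))" for g
  define \<beta> where "\<beta> g = snd (f (g, 0))" for g
  have "\<beta> \<in> hom (alt_group 5) (integer_mod_group 2)"
  proof (rule homI)
    fix g h assume gh: "g \<in> ?A" "h \<in> ?A"
    show "\<beta> g \<in> carrier (integer_mod_group 2)"
      using closed [OF gh(1), of 0] unfolding \<beta>_def carrier_C2 by auto
    show "\<beta> (g \<otimes>\<^bsub>alt_group 5\<^esub> h) = \<beta> g \<otimes>\<^bsub>integer_mod_group 2\<^esub> \<beta> h"
      using mult [OF gh, of 0 0] by (simp add: \<beta>_def alt_group_mult)
  qed
  then have "\<beta> g = 0" if "g \<in> ?A" for g
    using hom_alt_group_C2_trivial that by blast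
  then have f0: "f (g, 0) = (\<alpha> g, 0)" if "g \<in> ?A" for g
    using that by (simp add: \<alpha>_def \<beta>_def prod_eq_iff)
  have "\<alpha> \<in> hom (alt_group 5) (alt_group 5)"
  proof (rule homI)
    fix g h assume gh: "g \<in> ?A" "h \<in> ?A"
    show "\<alpha> g \<in> ?A"
      using closed [OF gh(1), of 0] unfolding \<alpha>_def by auto
    show "\<alpha> (g \<otimes>\<^bsub>alt_group 5\<^esub> h) = \<alpha> g \<otimes>\<^bsub>alt_group 5\<^esub> \<alpha> h"
      using mult [OF gh, of 0 0] by (simp add: \<alpha>_def alt_group_mult)
  qed
  moreover have "inj_on \<alpha> ?A"
  proof (rule inj_onI)
    fix g h assume gh: "g \<in> ?A" "h \<in> ?A" "\<alpha> g = \<alpha> h"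
    then have "f (g, 0) = f (h, 0)"
      using f0 by simp
    then have "(g, 0) = (h, 0::int)"
      by (rule inj_onD [OF inj]) (use gh in \<open>simp_all add: carrier_C2\<close>)
    then show "g = h" by simp
  qed
  ultimately obtain s where s: "s permutes {1..5}" "\<And>g. g \<in> ?A \<Longrightarrow> \<alpha> g = s \<circ> g \<circ> inv' s"
    using alt_group_5_automorphism_inner_in_sym by blast
  \<comment> \<open>The image of the central involution. Its first coordinate commutes with all
    values of \<open>\<alpha>\<close>, which fill the alternating group, and is therefore
    trivial.\<close>
  obtain z d where zd: "f (id, 1) = (z, d)" by fastforce
  have z: "z \<in> ?A" "d \<in> {0, 1}"
    using closed [OF id, of 1] zd by auto
  have "z = id"
  proof (rule centralizer_of_alt_group_trivial)
    show "z permutes {1..5}"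
      using z by (simp add: alt_group_carrier)
    fix h assume h: "h \<in> ?A"
    \<comment> \<open>The preimage of \<open>h\<close> under \<open>\<alpha>\<close>, found by
      undoing the conjugation.\<close>
    define g where "g = inv' s \<circ> h \<circ> s"
    have g: "g \<in> ?A"
      using alt_group_conjugate [OF permutes_inv [OF s(1)] h] permutes_inv_inv [OF s(1)] by (simp add: g_def)
    have "\<alpha> g = h"
      using s(2) [OF g] permutes_inv_o [OF s(1)] unfolding g_def
      by (metis (no_types) comp_assoc comp_id id_comp)
    then show "z \<circ> h = h \<circ> z"
      using mult [OF id g, of 1 0] mult [OF g id, of 0 1] zd f0 [OF g] by simp
  qed
  \<comment> \<open>Otherwise \<open>(id, 1)\<close> and \<open>(id, 0)\<close> would have the same
    image.\<close>
  moreover have "d \<noteq> 0"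
  proof
    assume "d = 0"
    moreover have "\<alpha> id = id"
      using s(2) [OF id] permutes_inv_o [OF s(1)] by simp
    ultimately have "f (id, 1) = f (id, 0)"
      using zd f0 [OF id] \<open>z = id\<close> by simp
    then have "(id, 1) = (id :: nat \<Rightarrow> nat, 0::int)"
      by (rule inj_onD [OF inj]) (use id in \<open>simp_all add: carrier_C2\<close>)
    then show False by simp
  qed
  ultimately have f1: "f (g, 1) = (\<alpha> g, 1)" if "g \<in> ?A" for g
    using mult [OF that id, of 0 1] zd z(2) f0 [OF that] by auto
  have "f = conj_aut s"
  proof (rule extensionalityI [OF ext])
    show "conj_aut s \<in> extensional (carrier A5_times_C2)"
      by (simp add: conj_aut_def)
    fix x assume "x \<in> carrier A5_times_C2"
    then obtain g c where "x = (g, c)" "g \<in> ?A" "c = 0 \<or> c = 1"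
      by (auto simp: carrier_C2)
    then show "f x = conj_aut s x"
      using f0 f1 s(2) by (auto simp: conj_aut_apply)
  qed
  with s(1) show thesis
    by (rule that)
qed

lemma conj_aut_iso: "conj_aut \<in> iso (sym_group 5) (AutoGroup A5_times_C2)"
proof (rule isoI)
  show "conj_aut \<in> hom (sym_group 5) (AutoGroup A5_times_C2)"
  proof (rule homI)
    fix s t assume "s \<in> carrier (sym_group 5)" "t \<in> carrier (sym_group 5)"
    then have st: "s permutes {1..5}" "t permutes {1..5}"
      by (simp_all add: sym_group_carrier)
    show "conj_aut s \<in> carrier (AutoGroup A5_times_C2)"
      using conj_aut_in_auto [OF st(1)] by (simp add: AutoGroup_def)
    have "conj_aut s \<in> Bij (carrier A5_times_C2)" "conj_aut t \<in> Bij (carrier A5_times_C2)"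
      using conj_aut_in_auto st by (simp_all add: auto_def)
    moreover have "conj_aut (s \<circ> t) = compose (carrier A5_times_C2) (conj_aut s) (conj_aut t)"
    proof (rule extensionalityI [of _ "carrier A5_times_C2"])
      show "conj_aut (s \<circ> t) \<in> extensional (carrier A5_times_C2)"
        unfolding conj_aut_def by (rule restrict_extensional)
      fix x assume x: "x \<in> carrier A5_times_C2"
      show "conj_aut (s \<circ> t) x = compose (carrier A5_times_C2) (conj_aut s) (conj_aut t) x"
        unfolding compose_eq [OF x] by (rule conj_aut_comp [OF st x])
    qed (rule compose_extensional)
    ultimately show "conj_aut (s \<otimes>\<^bsub>sym_group 5\<^esub> t) = conj_aut s \<otimes>\<^bsub>AutoGroup A5_times_C2\<^esub> conj_aut t"
      by (simp add: AutoGroup_def BijGroup_def sym_group_mult)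
  qed
  show "bij_betw conj_aut (carrier (sym_group 5)) (carrier (AutoGroup A5_times_C2))"
    unfolding bij_betw_def
  proof
    show "inj_on conj_aut (carrier (sym_group 5))"
      by (rule inj_onI) (simp add: sym_group_carrier conj_aut_inj)
    show "conj_aut ` carrier (sym_group 5) = carrier (AutoGroup A5_times_C2)"
      by (auto simp: AutoGroup_def sym_group_carrier conj_aut_in_auto elim: automorphism_is_conj_aut)
  qed
qed

text \<open>The second factor is commutative, so conjugation depends only on the first coordinate of
  the conjugating element, an even permutation.\<close>

lemma InnGroup_eq_conj_aut:
  "InnGroup A5_times_C2 = AutoGroup A5_times_C2 \<lparr>carrier := conj_aut ` carrier (alt_group 5)\<rparr>"
proof -
  have inner: "(\<lambda>x\<in>carrier A5_times_C2. k \<otimes>\<^bsub>A5_times_C2\<^esub> x \<otimes>\<^bsub>A5_times_C2\<^esub> inv\<^bsub>A5_times_C2\<^esub> k) = conj_aut (fst k)"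
    if k_mem: "k \<in> carrier A5_times_C2" for k
  proof (rule extensionalityI [of _ "carrier A5_times_C2"])
    obtain g c where k: "k = (g, c)" "g \<in> carrier (alt_group 5)" "c \<in> {0, 1}"
      using k_mem by (auto simp: carrier_C2)
    have c: "c \<in> carrier (integer_mod_group 2)"
      using k(3) by (simp only: carrier_C2)
    have inv_k: "inv\<^bsub>A5_times_C2\<^esub> k = (inv' g, (- c) mod 2)"
      unfolding k(1) inv_DirProd [OF alt_group_is_group group_integer_mod_group k(2) c]
      using c by (simp add: alt_group_inv_equality [OF k(2)])
    fix x assume x: "x \<in> carrier A5_times_C2"
    then obtain h d where h: "x = (h, d)" "h \<in> carrier (alt_group 5)" "d \<in> {0, 1}"
      by (auto simp: carrier_C2)
    have "((c + d) mod 2 + - c mod 2) mod 2 = d"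
      using k(3) h(3) by auto
    then have "k \<otimes>\<^bsub>A5_times_C2\<^esub> x \<otimes>\<^bsub>A5_times_C2\<^esub> inv\<^bsub>A5_times_C2\<^esub> k = conj_aut (fst k) x"
      unfolding inv_k unfolding k(1) h(1) mult_A5_times_C2 conj_aut_apply [OF h(2,3)] by simp
    then show "(\<lambda>x\<in>carrier A5_times_C2. k \<otimes>\<^bsub>A5_times_C2\<^esub> x \<otimes>\<^bsub>A5_times_C2\<^esub> inv\<^bsub>A5_times_C2\<^esub> k) x
      = conj_aut (fst k) x"
      unfolding restrict_apply' [OF x] .
  qed (simp_all add: conj_aut_def)
  have "{(\<lambda>x\<in>carrier A5_times_C2. k \<otimes>\<^bsub>A5_times_C2\<^esub> x \<otimes>\<^bsub>A5_times_C2\<^esub> inv\<^bsub>A5_times_C2\<^esub> k) | k.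
      k \<in> carrier A5_times_C2} = conj_aut ` fst ` carrier A5_times_C2"
    using inner by (auto simp: image_iff) (metis)+
  also have "fst ` carrier A5_times_C2 = carrier (alt_group 5)"
    by (simp add: carrier_C2)
  finally show ?thesis
    unfolding InnGroup_def by (rule arg_cong)
qed

section \<open>The representation\<close>

text \<open>Carries an isomorphism of the full groups over to the inner automorphisms and the
  type-preserving correlations.\<close>

lemma iso_restrict_carrier:
  assumes "h \<in> iso G H" "B \<subseteq> carrier G"
  shows "h \<in> iso (G\<lparr>carrier := B\<rparr>) (H\<lparr>carrier := h ` B\<rparr>)"
proof -
  have "inj_on h B"
    using assms by (auto simp: iso_def bij_betw_def intro: inj_on_subset)
  moreover have "h (x \<otimes>\<^bsub>G\<^esub> y) = h x \<otimes>\<^bsub>H\<^esub> h y" if "x \<in> B" "y \<in> B" for x y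
    using assms that by (intro hom_mult [of h G H]) (auto simp: iso_def)
  ultimately show ?thesis
    by (simp add: iso_def hom_def bij_betw_def)
qed

theorem mainTheorem4:
  shows "incidence_geometric_representation (alt_group 5 \<times>\<times> integer_mod_group 2) gelems gtype ginc
       \<and> InnGroup (alt_group 5 \<times>\<times> integer_mod_group 2) \<cong> alt_group 5
       \<and> AutoGroup (alt_group 5 \<times>\<times> integer_mod_group 2) \<cong> sym_group 5"
proof -
  let ?A = "carrier (alt_group 5)" and ?S = "carrier (sym_group 5)"
  let ?act = "\<lambda>s. restrict (act s) gelems"
  \<comment> \<open>Both full groups are copies of the symmetric group: an automorphism is traced
    back to its permutation and then sent to the correlation induced by it.\<close>
  define \<phi> where "\<phi> = ?act \<circ> inv_into ?S conj_aut"
  have sub: "?A \<subseteq> ?S"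
    by (auto simp: alt_group_carrier sym_group_carrier)
  have inj: "inj_on conj_aut ?S"
    using conj_aut_iso by (simp add: iso_def bij_betw_def)
  have inv_iso: "inv_into ?S conj_aut \<in> iso (AutoGroup A5_times_C2) (sym_group 5)"
    by (rule group.iso_set_sym [OF sym_group_is_group conj_aut_iso])
  have \<phi>: "\<phi> \<in> iso (AutoGroup A5_times_C2) (CorGroup gelems gtype ginc)"
    unfolding \<phi>_def by (rule iso_set_trans [OF inv_iso act_iso])
  have inner: "conj_aut ` ?A \<subseteq> carrier (AutoGroup A5_times_C2)"
    using conj_aut_iso sub by (auto simp: iso_def bij_betw_def)
  \<comment> \<open>The same \<open>\<phi>\<close> serves as both maps of the representation, so
    their agreement on inner automorphisms is immediate. Both subgroups correspond to the even
    permutations.\<close>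
  have \<phi>I: "\<phi> \<in> iso (InnGroup A5_times_C2) (CorGroupI gelems gtype ginc)"
  proof -
    have "\<phi> ` conj_aut ` ?A = ?act ` ?A"
      unfolding \<phi>_def image_image using inv_into_f_f [OF inj] sub by (intro image_cong) auto
    with iso_restrict_carrier [OF \<phi> inner] show ?thesis
      by (simp add: InnGroup_eq_conj_aut CorGroupI_eq_act)
  qed
  have "conj_aut \<in> iso (alt_group 5) (InnGroup A5_times_C2)"
  proof -
    have alt: "sym_group 5\<lparr>carrier := ?A\<rparr> = alt_group 5"
      by (simp add: alt_group_def)
    show ?thesis
      using iso_restrict_carrier [OF conj_aut_iso sub] unfolding alt InnGroup_eq_conj_aut .
  qed
  then have "InnGroup A5_times_C2 \<cong> alt_group 5"
    using group.iso_sym [OF alt_group_is_group] by (auto simp: is_iso_def)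
  moreover have "AutoGroup A5_times_C2 \<cong> sym_group 5"
    using inv_iso by (auto simp: is_iso_def)
  ultimately show ?thesis
    unfolding incidence_geometric_representation_def
    using incidence_system_gelems \<phi> \<phi>I by blast
qed

end
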